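(* Every instance $(A,C,U,k,\ell,x)$ of RMPV with $n$ agents, $m$ candidates and $\tau$ voting profiles can be decided in $O(\tau\cdot \ell^4 m^{4\ell+1} n)$ time.
   Context: An instance of RMPV (\textsc{Revolutionary Multistage Plurality Voting}) consists of a set of agents $A=\{a_1,\dots,a_n\}$, a set of candidates $C=\{c_1,\dots,c_m\}$, a sequence $U=(u_1,\dots,u_\tau)$ of voting profiles with $u_t\colon A\to C\cup\{\emptyset\}$, and integers $k\in\mathbb{N}$, $\ell\in\mathbb{N}_0$, $x\in\mathbb{N}$. For $C'\subseteq C$ let $\mathrm{score}_t(C')=|u_t^{-1}(C')|$. The question is whether there is a sequence $(C_1,\dots,C_\tau)$ of committees $C_t\subseteq C$ with $|C_t|\le k$ and $\mathrm{score}_t(C_t)\ge x$ for all $t\in\{1,\dots,\tau\}$, and $|C_t\triangle C_{t+1}|\ge \ell$ for all $t\in\{1,\dots,\tau-1\}$.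
   Formalization: Since ℓ = 0 is allowed and would make the stated bound 0, each of the factors τ, ℓ, m, n is read as 1 when it is zero; for τ, ℓ, m, n ≥ 1 the bound is as stated, on a uniform-cost RAM with one program and one constant for all instances. *)

theory Defs
  imports Main
begin

section \<open>Revolutionary Multistage Plurality Voting\<close>

text \<open>A profile sends an agent to \<open>None\<close> where the agent votes for no candidate.
  Values of a profile outside the set of agents are irrelevant.\<close>

record ('a, 'c) rmpv =
  agents :: "'a set"
  candidates :: "'c set"
  profiles :: "('a \<Rightarrow> 'c option) list"
  committee_size :: nat   \<comment> \<open>\<open>k\<close>\<close>
  min_change :: nat       \<comment> \<open>\<open>\<ell>\<close>\<close>
  min_score :: nat        \<comment> \<open>\<open>x\<close>\<close>

definition rmpv_instance :: "('a, 'c) rmpv \<Rightarrow> bool" where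
  "rmpv_instance I \<longleftrightarrow>
     finite (agents I) \<and> finite (candidates I) \<and>
     (\<forall>u \<in> set (profiles I). u ` agents I \<subseteq> insert None (Some ` candidates I)) \<and>
     committee_size I \<ge> 1 \<and> min_score I \<ge> 1"

definition score :: "'a set \<Rightarrow> ('a \<Rightarrow> 'c option) \<Rightarrow> 'c set \<Rightarrow> nat" where
  "score A u C' = card {a \<in> A. u a \<in> Some ` C'}"

definition rmpv_solution :: "('a, 'c) rmpv \<Rightarrow> 'c set list \<Rightarrow> bool" where
  "rmpv_solution I Cs \<longleftrightarrow>
     length Cs = length (profiles I) \<and>
     (\<forall>t < length (profiles I).
        Cs ! t \<subseteq> candidates I \<and> card (Cs ! t) \<le> committee_size I \<and>
        score (agents I) (profiles I ! t) (Cs ! t) \<ge> min_score I) \<and>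
     (\<forall>t. Suc t < length (profiles I) \<longrightarrow>
        card (sym_diff (Cs ! t) (Cs ! Suc t)) \<ge> min_change I)"

definition rmpv_yes :: "('a, 'c) rmpv \<Rightarrow> bool" where
  "rmpv_yes I \<longleftrightarrow> (\<exists>Cs. rmpv_solution I Cs)"


section \<open>Random access machine with uniform cost\<close>

text \<open>A random access machine with registers and an indirectly addressable memory, both
  indexed by and holding natural numbers. Programs are presented in structured form. Every
  elementary instruction and every evaluation of a branching or loop condition costs one time
  step. There is deliberately no unit-cost multiplication; \<open>SUB\<close> is truncated subtraction.\<close>

type_synonym store = "(nat \<Rightarrow> nat) \<times> (nat \<Rightarrow> nat)"

datatype ram =
    SKIP
  | SETC nat nat
  | ADD nat nat nat
  | SUB nat nat nat
  | LOAD nat nat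
  | STORE nat nat
  | SEQ ram ram
  | IFNZ nat ram ram
  | WHILENZ nat ram

inductive exec :: "ram \<Rightarrow> store \<Rightarrow> nat \<Rightarrow> store \<Rightarrow> bool" where
  Skip: "exec SKIP s 1 s"
| Const: "exec (SETC i c) (r, h) 1 (r(i := c), h)"
| Add: "exec (ADD i j k) (r, h) 1 (r(i := r j + r k), h)"
| Sub: "exec (SUB i j k) (r, h) 1 (r(i := r j - r k), h)"
| Load: "exec (LOAD i j) (r, h) 1 (r(i := h (r j)), h)"
| Store: "exec (STORE i j) (r, h) 1 (r, h(r i := r j))"
| Seq: "exec p s t s' \<Longrightarrow> exec q s' t' s'' \<Longrightarrow> exec (SEQ p q) s (t + t') s''"
| If_nonzero: "fst s i \<noteq> 0 \<Longrightarrow> exec p s t s' \<Longrightarrow> exec (IFNZ i p q) s (Suc t) s'"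
| If_zero: "fst s i = 0 \<Longrightarrow> exec q s t s' \<Longrightarrow> exec (IFNZ i p q) s (Suc t) s'"
| While_nonzero: "fst s i \<noteq> 0 \<Longrightarrow> exec p s t s' \<Longrightarrow> exec (WHILENZ i p) s' t' s'' \<Longrightarrow>
    exec (WHILENZ i p) s (Suc (t + t')) s''"
| While_zero: "fst s i = 0 \<Longrightarrow> exec (WHILENZ i p) s 1 s"

lemma exec_deterministic:
  "exec p s t s' \<Longrightarrow> exec p s t2 s2 \<Longrightarrow> t2 = t \<and> s2 = s'"
proof (induction arbitrary: t2 s2 rule: exec.induct)
  case (Seq p s t s' q t' s'')
  from Seq.prems obtain u s1 u' where
    "exec p s u s1" "exec q s1 u' s2" "t2 = u + u'" by cases
  with Seq.IH(1)[of u s1] Seq.IH(2)[of u' s2] show ?case by simp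
next
  case (If_nonzero s i p t s' q)
  from If_nonzero.prems show ?case
  proof cases
    case (If_nonzero u)
    with \<open>\<And>t2 s2. exec p s t2 s2 \<Longrightarrow> t2 = t \<and> s2 = s'\<close>[of u s2]
    show ?thesis by simp
  qed (use \<open>fst s i \<noteq> 0\<close> in simp)
next
  case (If_zero s i q t s' p)
  from If_zero.prems show ?case
  proof cases
    case (If_zero u)
    with \<open>\<And>t2 s2. exec q s t2 s2 \<Longrightarrow> t2 = t \<and> s2 = s'\<close>[of u s2]
    show ?thesis by simp
  qed (use \<open>fst s i = 0\<close> in simp)
next
  case (While_nonzero s i p t s' t' s'')
  from While_nonzero.prems show ?case
  proof cases
    case (While_nonzero u s1 u')
    with \<open>\<And>t2 s2. exec p s t2 s2 \<Longrightarrow> t2 = t \<and> s2 = s'\<close>[of u s1]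
      \<open>\<And>t2 s2. exec (WHILENZ i p) s' t2 s2 \<Longrightarrow> t2 = t' \<and> s2 = s''\<close>[of u' s2]
    show ?thesis by simp
  qed (use \<open>fst s i \<noteq> 0\<close> in simp)
next
  case (While_zero s i p)
  from While_zero.prems show ?case
    by cases (use While_zero.hyps in simp_all)
qed (erule exec.cases; simp)+

text \<open>The input word occupies the first memory cells; all other cells and all registers are
  initially zero. The answer is returned in register 0.\<close>

definition initial_store :: "nat list \<Rightarrow> store" where
  "initial_store w = (\<lambda>_. 0, \<lambda>i. if i < length w then w ! i else 0)"

definition decides_within :: "ram \<Rightarrow> nat list \<Rightarrow> bool \<Rightarrow> nat \<Rightarrow> bool" where
  "decides_within p w b T \<longleftrightarrow>
     (\<exists>t s. exec p (initial_store w) t s \<and> t \<le> T \<and> fst s 0 = (if b then 1 else 0))"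


section \<open>Encoding of instances\<close>

text \<open>Relative to enumerations \<open>as\<close> of the agents and \<open>cs\<close> of the candidates, a vote is
  encoded by the position of the candidate in \<open>cs\<close>, counted from 1, and by 0 for \<open>None\<close>.\<close>

fun encode_vote :: "'c list \<Rightarrow> 'c option \<Rightarrow> nat" where
  "encode_vote cs None = 0"
| "encode_vote cs (Some c) = Suc (length (takeWhile (\<lambda>d. d \<noteq> c) cs))"

definition encode_rmpv :: "('a, 'c) rmpv \<Rightarrow> 'a list \<Rightarrow> 'c list \<Rightarrow> nat list" where
  "encode_rmpv I as cs =
     [length as, length cs, length (profiles I), committee_size I, min_change I, min_score I] @
     concat (map (\<lambda>u. map (\<lambda>a. encode_vote cs (u a)) as) (profiles I))"

end

theory Submission
  imports Defs
begin

text \<open>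
  A committee \<open>C\<^sub>t\<close> of a solution interacts with its neighbours only through \<open>\<ell>\<close> witnesses for
  \<open>|C\<^sub>t\<^sub>-\<^sub>1 \<triangle> C\<^sub>t| \<ge> \<ell>\<close> and \<open>\<ell>\<close> witnesses for \<open>|C\<^sub>t \<triangle> C\<^sub>t\<^sub>+\<^sub>1| \<ge> \<ell>\<close>. Let \<open>X\<close> be the
  witnesses in \<open>C\<^sub>t\<close> and \<open>Y\<close> those outside. Any committee that contains \<open>X\<close> and avoids \<open>Y\<close> keeps both
  distances, so \<open>C\<^sub>t\<close> may be replaced by \<open>X\<close> together with the \<open>k - |X|\<close> highest scoring candidates
  outside \<open>X \<union> Y\<close>. The pairs \<open>(X, Y)\<close> are given by words of length \<open>2\<ell>\<close> over the candidates and a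
  position \<open>q \<le> 2\<ell>\<close> that separates \<open>X\<close> from \<open>Y\<close>. Hence \<open>(2\<ell> + 1) m\<^bsup>2\<ell>\<^esup>\<close> committees per stage
  suffice, and comparing those of consecutive stages takes \<open>O(\<ell>\<^sup>2 m\<^bsup>4\<ell>+1\<^esup>)\<close> steps.

  The machine keeps the feasible committees of all stages as consecutive 0/1 records of \<open>m\<close> cells.
  Greedy completion scans the candidates once for every vote count from \<open>n\<close> down to 1, which costs
  \<open>O(nm)\<close> and so respects the bound \<open>O(\<tau>mn)\<close> of the case \<open>\<ell> = 0\<close>.
\<close>

section \<open>Weakest preconditions with a time counter\<close>

definition wp ::
  "ram \<Rightarrow> ((nat \<Rightarrow> nat) \<Rightarrow> (nat \<Rightarrow> nat) \<Rightarrow> nat \<Rightarrow> bool) \<Rightarrow>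
   (nat \<Rightarrow> nat) \<Rightarrow> (nat \<Rightarrow> nat) \<Rightarrow> nat \<Rightarrow> bool" where
  "wp p Q r h t \<longleftrightarrow> (\<exists>u r' h'. exec p (r, h) u (r', h') \<and> Q r' h' (t + u))"

lemma wp_SKIP [simp]: "wp SKIP Q r h t = Q r h (Suc t)"
  by (auto simp: wp_def elim: exec.cases intro: exec.Skip) (metis Skip Suc_eq_plus1)

lemma wp_SETC [simp]: "wp (SETC i c) Q r h t = Q (r(i := c)) h (Suc t)"
  unfolding wp_def by (rule iffI, auto elim: exec.cases) (metis Const Suc_eq_plus1)

lemma wp_ADD [simp]: "wp (ADD i j k) Q r h t = Q (r(i := r j + r k)) h (Suc t)"
  unfolding wp_def by (rule iffI, auto elim: exec.cases) (metis Add Suc_eq_plus1)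

lemma wp_SUB [simp]: "wp (SUB i j k) Q r h t = Q (r(i := r j - r k)) h (Suc t)"
  unfolding wp_def by (rule iffI, auto elim: exec.cases) (metis Sub Suc_eq_plus1)

lemma wp_LOAD [simp]: "wp (LOAD i j) Q r h t = Q (r(i := h (r j))) h (Suc t)"
  unfolding wp_def by (rule iffI, auto elim: exec.cases) (metis Load Suc_eq_plus1)

lemma wp_STORE [simp]: "wp (STORE i j) Q r h t = Q r (h(r i := r j)) (Suc t)"
  unfolding wp_def by (rule iffI, auto elim: exec.cases) (metis Store Suc_eq_plus1)

lemma wp_SEQ [simp]: "wp (SEQ p q) Q r h t = wp p (wp q Q) r h t"
proof
  assume "wp (SEQ p q) Q r h t"
  then obtain u r' h' where e: "exec (SEQ p q) (r, h) u (r', h')" and Q: "Q r' h' (t + u)"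
    unfolding wp_def by blast
  from e obtain u1 s1 u2 where
    "exec p (r, h) u1 s1" "exec q s1 u2 (r', h')" "u = u1 + u2"
    by cases
  with Q show "wp p (wp q Q) r h t"
    unfolding wp_def by (cases s1) (metis add.assoc)
next
  assume "wp p (wp q Q) r h t"
  then show "wp (SEQ p q) Q r h t"
    unfolding wp_def by (metis Seq add.assoc)
qed

lemma wp_IFNZ [simp]:
  "wp (IFNZ i p q) Q r h t = (if r i \<noteq> 0 then wp p Q r h (Suc t) else wp q Q r h (Suc t))"
proof (cases "r i = 0")
  case True
  have "exec (IFNZ i p q) (r, h) u s \<longleftrightarrow> (\<exists>v. u = Suc v \<and> exec q (r, h) v s)" for u s
    using True by (auto elim: exec.cases intro: exec.If_zero)
  then show ?thesis using True unfolding wp_def by simp (metis add_Suc_right)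
next
  case False
  have "exec (IFNZ i p q) (r, h) u s \<longleftrightarrow> (\<exists>v. u = Suc v \<and> exec p (r, h) v s)" for u s
    using False by (auto elim: exec.cases intro: exec.If_nonzero)
  then show ?thesis using False unfolding wp_def by simp (metis add_Suc_right)
qed

lemma wp_while:
  assumes init: "Inv 0 r h t"
    and step: "\<And>i r h t. i < N \<Longrightarrow> Inv i r h t \<Longrightarrow>
      r c \<noteq> 0 \<and> wp p (Inv (Suc i)) r h (Suc t)"
    and exit: "\<And>r h t. Inv N r h t \<Longrightarrow> r c = 0 \<and> Q r h (Suc t)"
  shows "wp (WHILENZ c p) Q r h t"
proof -
  have "wp (WHILENZ c p) Q r h t" if "Inv i r h t" "i \<le> N" for i r h t
    using that
  proof (induction "N - i" arbitrary: i r h t)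
    case 0
    then have "Inv N r h t" by simp
    from exit[OF this] show ?case
      unfolding wp_def using While_zero[of "(r, h)" c p] by (metis Suc_eq_plus1 fst_conv)
  next
    case (Suc d)
    then have "i < N" by simp
    from step[OF this Suc.prems(1)] obtain u r' h' where
      nz: "r c \<noteq> 0" and e: "exec p (r, h) u (r', h')" and I: "Inv (Suc i) r' h' (Suc t + u)"
      unfolding wp_def by blast
    have "wp (WHILENZ c p) Q r' h' (Suc t + u)"
      using Suc.hyps(1)[OF _ I] Suc.hyps(2) \<open>i < N\<close> by simp
    then obtain v r'' h'' where
      "exec (WHILENZ c p) (r', h') v (r'', h'')" "Q r'' h'' (Suc t + u + v)"
      unfolding wp_def by blast
    with While_nonzero[OF _ e] nz have "exec (WHILENZ c p) (r, h) (Suc (u + v)) (r'', h'')"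
      by simp
    with \<open>Q r'' h'' (Suc t + u + v)\<close> show ?case
      unfolding wp_def by (intro exI[of _ "Suc (u + v)"] exI[of _ r''] exI[of _ h'']) (simp add: add.assoc)
  qed
  from this[OF init] show ?thesis by simp
qed

notation SEQ (infixr ";;" 60)

section \<open>The loops of the program\<close>

text \<open>Registers below 22 hold the parameters, 30 to 40 the state of the search, 50 to 58 the results
  of the routines, and registers from 60 on are scratch registers of single loops. Frame
  conditions are therefore bounds on register numbers.\<close>

abbreviation (input) "r_n \<equiv> 10 :: nat"
abbreviation (input) "r_m \<equiv> 11 :: nat"
abbreviation (input) "r_stages \<equiv> 12 :: nat"
abbreviation (input) "r_k \<equiv> 13 :: nat"
abbreviation (input) "r_l \<equiv> 14 :: nat"
abbreviation (input) "r_x \<equiv> 15 :: nat"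
abbreviation (input) "r_one \<equiv> 16 :: nat"
abbreviation (input) "r_two \<equiv> 17 :: nat"
abbreviation (input) "r_L \<equiv> 18 :: nat"
abbreviation (input) "r_cnt \<equiv> 19 :: nat"
abbreviation (input) "r_word \<equiv> 20 :: nat"
abbreviation (input) "r_zero \<equiv> 21 :: nat"
abbreviation (input) "r_votes \<equiv> 30 :: nat"
abbreviation (input) "r_prev \<equiv> 31 :: nat"
abbreviation (input) "r_cur \<equiv> 32 :: nat"
abbreviation (input) "r_first \<equiv> 33 :: nat"
abbreviation (input) "r_qs \<equiv> 34 :: nat"
abbreviation (input) "r_q \<equiv> 35 :: nat"
abbreviation (input) "r_go \<equiv> 36 :: nat"
abbreviation (input) "r_top \<equiv> 40 :: nat"
abbreviation (input) "r_budget \<equiv> 50 :: nat"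
abbreviation (input) "r_level \<equiv> 51 :: nat"
abbreviation (input) "r_size \<equiv> 52 :: nat"
abbreviation (input) "r_score \<equiv> 53 :: nat"
abbreviation (input) "r_found \<equiv> 54 :: nat"
abbreviation (input) "r_rec \<equiv> 55 :: nat"
abbreviation (input) "r_rem \<equiv> 56 :: nat"
abbreviation (input) "r_dist \<equiv> 57 :: nat"
abbreviation (input) "r_carry \<equiv> 58 :: nat"
abbreviation (input) "r_ptr \<equiv> 60 :: nat"
abbreviation (input) "r_ctr \<equiv> 61 :: nat"
abbreviation (input) "r_val \<equiv> 62 :: nat"
abbreviation (input) "r_ptr2 \<equiv> 63 :: nat"
abbreviation (input) "r_a \<equiv> 64 :: nat"
abbreviation (input) "r_b \<equiv> 65 :: nat"
abbreviation (input) "r_c \<equiv> 66 :: nat"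
abbreviation (input) "r_d \<equiv> 67 :: nat"

definition fill :: ram where
  "fill = WHILENZ r_ctr
     (STORE r_ptr r_val ;; ADD r_ptr r_ptr r_one ;; SUB r_ctr r_ctr r_one)"

lemma wp_fill:
  assumes one: "r r_one = 1"
    and Q: "\<And>r' h' t'. \<forall>i<60. r' i = r i \<Longrightarrow>
      h' = (\<lambda>a. if r r_ptr \<le> a \<and> a < r r_ptr + r r_ctr then r r_val else h a) \<Longrightarrow>
      t' \<le> t + 4 * r r_ctr + 1 \<Longrightarrow> Q r' h' t'"
  shows "wp fill Q r h t"
  unfolding fill_def
proof (rule wp_while[where N = "r r_ctr" and Inv = "\<lambda>i r' h' t'. (\<forall>j<60. r' j = r j) \<and>
    r' r_val = r r_val \<and> r' r_ptr = r r_ptr + i \<and> r' r_ctr = r r_ctr - i \<and>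
    h' = (\<lambda>a. if r r_ptr \<le> a \<and> a < r r_ptr + i then r r_val else h a) \<and> t' \<le> t + 4 * i"])
qed (use one in \<open>auto intro!: Q\<close>)

text \<open>Array cells are addressed by candidate numbers \<open>1..m\<close>; abstentions are counted in cell 0,
  which is never read.\<close>

definition count_votes :: ram where
  "count_votes = ADD r_ctr r_n r_zero ;; WHILENZ r_ctr
     (LOAD r_a r_votes ;; ADD r_votes r_votes r_one ;; ADD r_a r_cnt r_a ;;
      LOAD r_b r_a ;; ADD r_b r_b r_one ;; STORE r_a r_b ;; SUB r_ctr r_ctr r_one)"

lemma wp_count_votes:
  assumes one: "r r_one = 1" and zero: "r r_zero = 0"
    and votes: "\<And>i. i < r r_n \<Longrightarrow> h (r r_votes + i) \<le> r r_m"
    and le: "r r_votes + r r_n \<le> r r_cnt"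
    and Q: "\<And>r' h' t'. \<forall>i<60. i \<noteq> r_votes \<longrightarrow> r' i = r i \<Longrightarrow>
      r' r_votes = r r_votes + r r_n \<Longrightarrow>
      \<forall>a. a < r r_cnt \<or> r r_cnt + r r_m < a \<longrightarrow> h' a = h a \<Longrightarrow>
      \<forall>j. h' (r r_cnt + j) = h (r r_cnt + j) + card {i. i < r r_n \<and> h (r r_votes + i) = j} \<Longrightarrow>
      t' \<le> t + 8 * r r_n + 2 \<Longrightarrow> Q r' h' t'"
  shows "wp count_votes Q r h t"
  unfolding count_votes_def wp_SEQ wp_ADD
proof (rule wp_while[where N = "r r_n" and Inv = "\<lambda>i r' h' t'.
    (\<forall>j<60. j \<noteq> r_votes \<longrightarrow> r' j = r j) \<and> r' r_votes = r r_votes + i \<and> r' r_ctr = r r_n - i \<and>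
    (\<forall>a. a < r r_cnt \<or> r r_cnt + r r_m < a \<longrightarrow> h' a = h a) \<and>
    (\<forall>j. h' (r r_cnt + j) = h (r r_cnt + j) + card {i'. i' < i \<and> h (r r_votes + i') = j}) \<and>
    t' \<le> t + 8 * i + 1"], goal_cases)
  case 1
  then show ?case using zero by auto
next
  case (2 i r' h' t')
  have eq: "{i'. i' < Suc i \<and> h (r r_votes + i') = j} =
    (if h (r r_votes + i) = j then insert i {i'. i' < i \<and> h (r r_votes + i') = j}
     else {i'. i' < i \<and> h (r r_votes + i') = j})" for j
    by (auto simp: less_Suc_eq)
  have "h' (r r_votes + i) = h (r r_votes + i)" using 2 le by auto
  moreover have "h (r r_votes + i) \<le> r r_m" using 2 votes by simp
  ultimately show ?case using 2 one by (auto simp: eq)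
next
  case (3 r' h' t')
  then show ?case by (auto intro!: Q)
qed

definition label :: ram where
  "label = ADD r_ptr r_word r_zero ;; ADD r_ctr r_L r_zero ;; ADD r_c r_q r_zero ;;
     ADD r_budget r_k r_zero ;; WHILENZ r_ctr
     (LOAD r_a r_ptr ;; ADD r_a r_top r_a ;;
      IFNZ r_c
        (SUB r_c r_c r_one ;; LOAD r_b r_a ;;
         IFNZ r_b SKIP (STORE r_a r_one ;; SUB r_budget r_budget r_one))
        (STORE r_a r_two) ;;
      ADD r_ptr r_ptr r_one ;; SUB r_ctr r_ctr r_one)"

lemma wp_label:
  assumes regs: "r r_one = 1" "r r_two = 2" "r r_zero = 0"
    and q: "r r_q \<le> r r_L"
    and word: "\<And>i. i < r r_L \<Longrightarrow> h (r r_word + i) \<in> {1..r r_m}"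
    and le: "r r_word + r r_L \<le> Suc (r r_top)"
    and clear: "\<And>j. j \<in> {1..r r_m} \<Longrightarrow> h (r r_top + j) = 0"
    and Q: "\<And>r' h' t'. \<forall>i<60. i \<noteq> r_budget \<longrightarrow> r' i = r i \<Longrightarrow>
      r' r_budget = r r_k - card ((\<lambda>i. h (r r_word + i)) ` {..<r r_q}) \<Longrightarrow>
      \<forall>a. a \<le> r r_top \<or> r r_top + r r_m < a \<longrightarrow> h' a = h a \<Longrightarrow>
      \<forall>j\<in>{1..r r_m}. h' (r r_top + j) =
        (if j \<in> (\<lambda>i. h (r r_word + i)) ` {r r_q..<r r_L} then 2
         else if j \<in> (\<lambda>i. h (r r_word + i)) ` {..<r r_q} then 1 else 0) \<Longrightarrow>
      t' \<le> t + 11 * r r_L + 5 \<Longrightarrow> Q r' h' t'"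
  shows "wp label Q r h t"
proof -
  define d where "d = (\<lambda>i. h (r r_word + i))"
  show ?thesis
    unfolding label_def wp_SEQ wp_ADD
  proof (rule wp_while[where N = "r r_L" and Inv = "\<lambda>i r' h' t'.
      (\<forall>j<60. j \<noteq> r_budget \<longrightarrow> r' j = r j) \<and> r' r_ptr = r r_word + i \<and> r' r_ctr = r r_L - i \<and>
      r' r_c = r r_q - i \<and> r' r_budget = r r_k - card (d ` {..<min (r r_q) i}) \<and>
      (\<forall>a. a \<le> r r_top \<or> r r_top + r r_m < a \<longrightarrow> h' a = h a) \<and>
      (\<forall>j\<in>{1..r r_m}. h' (r r_top + j) =
          (if j \<in> d ` {r r_q..<i} then 2 else if j \<in> d ` {..<min (r r_q) i} then 1 else 0)) \<and>
      t' \<le> t + 11 * i + 4"], goal_cases)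
    case 1
    then show ?case using regs clear by simp
  next
    case (2 i r' h' t')
    have di: "h' (r r_word + i) = d i" "d i \<in> {1..r r_m}" using 2 le word by (auto simp: d_def)
    show ?case
    proof (cases "i < r r_q")
      case True
      then have "min (r r_q) i = i" "min (r r_q) (Suc i) = Suc i" "{r r_q..<i} = {}"
        "{r r_q..<Suc i} = {}" by auto
      then show ?thesis using 2 di regs True
        by (auto simp: lessThan_Suc card_insert_if)
    next
      case False
      then have "min (r r_q) i = r r_q" "min (r r_q) (Suc i) = r r_q"
        "{r r_q..<Suc i} = insert i {r r_q..<i}" by auto
      then show ?thesis using 2 di regs False by auto
    qed
  next
    case (3 r' h' t')
    then show ?case using q by (auto intro!: Q simp: d_def min_def)
  qed
qed

text \<open>\<open>F\<close> are the free candidates, \<open>P\<close> those already scanned, \<open>A\<close> the chosen ones, and \<open>b\<close> is what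
  remains of the budget \<open>b0\<close>.\<close>

definition greedy_inv ::
  "nat set \<Rightarrow> (nat \<Rightarrow> nat) \<Rightarrow> nat \<Rightarrow> nat set \<Rightarrow> nat set \<Rightarrow> nat \<Rightarrow> bool" where
  "greedy_inv F g b0 P A b \<longleftrightarrow> A \<subseteq> F \<and> card A + b = b0 \<and> (b > 0 \<longrightarrow> A = P) \<and>
     (\<forall>a\<in>A. \<forall>f\<in>F - A. g f \<le> g a)"

lemma greedy_inv_add:
  assumes "greedy_inv F g b0 P A b" "finite F" "j \<in> F" "j \<notin> A" "b > 0"
    and "\<And>f. f \<in> F - P \<Longrightarrow> g f \<le> g j"
  shows "greedy_inv F g b0 (insert j P) (insert j A) (b - 1)"
  using assms finite_subset[of A F] by (auto simp: greedy_inv_def)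

lemma greedy_inv_optimal:
  assumes inv: "greedy_inv F g b0 {f \<in> F. g f > 0} A b" and fin: "finite F"
    and S: "S \<subseteq> F" "card S \<le> b0"
  shows "sum g S \<le> sum g A"
proof (cases "b > 0")
  case True
  then have A: "A = {f \<in> F. g f > 0}" using inv by (simp add: greedy_inv_def)
  have "sum g S = sum g (S \<inter> A)"
    by (rule sum.mono_neutral_right) (use A S fin finite_subset in auto)
  also have "\<dots> \<le> sum g A"
    by (rule sum_mono2) (use A fin in auto)
  finally show ?thesis .
next
  case False
  have finA: "finite A" and finS: "finite S"
    using inv fin S finite_subset by (auto simp: greedy_inv_def)
  have "card A = b0" using inv False by (simp add: greedy_inv_def)
  then have "card S \<le> card A" using S by simp
  moreover have "card S = card (S \<inter> A) + card (S - A)"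
    using finS by (metis Int_Diff_Un Int_Diff_disjoint card_Un_disjoint finite_Diff finite_Int)
  moreover have "card A = card (S \<inter> A) + card (A - S)"
    using finA by (metis Int_Diff_Un Int_Diff_disjoint Int_commute card_Un_disjoint finite_Diff finite_Int)
  ultimately have le: "card (S - A) \<le> card (A - S)" by linarith
  have "sum g (S - A) \<le> sum g (A - S)"
  proof (cases "S - A = {}")
    case False
    define M where "M = Max (g ` (S - A))"
    have "sum g (S - A) \<le> card (S - A) * M"
      using sum_bounded_above[of "S - A" g M] finS by (simp add: M_def)
    also have "\<dots> \<le> card (A - S) * M" using le by simp
    also have "\<dots> \<le> sum g (A - S)"
    proof -
      have "M \<in> g ` (S - A)" unfolding M_def using False finS by (intro Max_in) auto
      then have "M \<le> g a" if "a \<in> A - S" for a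
        using that inv S by (auto simp: greedy_inv_def)
      then show ?thesis using sum_bounded_below[of "A - S" M g] by simp
    qed
    finally show ?thesis .
  qed (metis sum.empty le0)
  moreover have "sum g S = sum g (S \<inter> A) + sum g (S - A)"
    using finS by (metis sum.Int_Diff)
  moreover have "sum g A = sum g (S \<inter> A) + sum g (A - S)"
    using finA by (metis sum.Int_Diff Int_commute)
  ultimately show ?thesis by linarith
qed

definition greedy_round :: ram where
  "greedy_round = ADD r_ptr r_top r_one ;; ADD r_ptr2 r_cnt r_one ;; ADD r_ctr r_m r_zero ;;
     WHILENZ r_ctr
     (LOAD r_a r_ptr ;;
      IFNZ r_a SKIP
        (LOAD r_b r_ptr2 ;; SUB r_c r_b r_level ;; SUB r_d r_level r_b ;; ADD r_c r_c r_d ;;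
         IFNZ r_c SKIP
           (IFNZ r_budget (STORE r_ptr r_one ;; SUB r_budget r_budget r_one) SKIP)) ;;
      ADD r_ptr r_ptr r_one ;; ADD r_ptr2 r_ptr2 r_one ;; SUB r_ctr r_ctr r_one)"

lemma wp_greedy_round:
  assumes regs: "r r_one = 1" "r r_zero = 0"
    and g: "\<And>j. j \<in> {1..r r_m} \<Longrightarrow> h (r r_cnt + j) = g j"
    and le: "r r_cnt + r r_m \<le> r r_top"
    and F: "F = {j \<in> {1..r r_m}. lab j = 0}"
    and lab: "\<forall>j\<in>{1..r r_m}. h (r r_top + j) = (if j \<in> A then 1 else lab j)"
    and inv: "greedy_inv F g b0 {f \<in> F. r r_level < g f} A (r r_budget)"
    and Q: "\<And>r' h' t' A'. \<forall>i<60. i \<noteq> r_budget \<longrightarrow> r' i = r i \<Longrightarrow>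
      \<forall>a. a \<le> r r_top \<or> r r_top + r r_m < a \<longrightarrow> h' a = h a \<Longrightarrow>
      \<forall>j\<in>{1..r r_m}. h' (r r_top + j) = (if j \<in> A' then 1 else lab j) \<Longrightarrow>
      greedy_inv F g b0 {f \<in> F. r r_level \<le> g f} A' (r' r_budget) \<Longrightarrow>
      t' \<le> t + 15 * r r_m + 4 \<Longrightarrow> Q r' h' t'"
  shows "wp greedy_round Q r h t"
proof -
  define P where "P = (\<lambda>i. {f \<in> F. r r_level < g f \<or> r r_level = g f \<and> f \<le> i})"
  have finF: "finite F" unfolding F by simp
  show ?thesis
    unfolding greedy_round_def wp_SEQ wp_ADD
  proof (rule wp_while[where N = "r r_m" and Inv = "\<lambda>i r' h' t'.
      (\<forall>j<60. j \<noteq> r_budget \<longrightarrow> r' j = r j) \<and> r' r_ptr = Suc (r r_top + i) \<and>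
      r' r_ptr2 = Suc (r r_cnt + i) \<and> r' r_ctr = r r_m - i \<and>
      (\<forall>a. a \<le> r r_top \<or> r r_top + r r_m < a \<longrightarrow> h' a = h a) \<and>
      (\<exists>A'. (\<forall>j\<in>{1..r r_m}. h' (r r_top + j) = (if j \<in> A' then 1 else lab j)) \<and>
        greedy_inv F g b0 (P i) A' (r' r_budget)) \<and>
      t' \<le> t + 15 * i + 3"], goal_cases)
    case 1
    have "P 0 = {f \<in> F. r r_level < g f}" unfolding P_def F by auto
    then show ?case using regs inv lab by auto
  next
    case (2 i r' h' t')
    then obtain A' where A': "\<forall>j\<in>{1..r r_m}. h' (r r_top + j) = (if j \<in> A' then 1 else lab j)"
      and inv': "greedy_inv F g b0 (P i) A' (r' r_budget)" by blast
    have Si: "Suc i \<in> {1..r r_m}" using 2 by simp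
    have hA: "h' (Suc (r r_top + i)) = (if Suc i \<in> A' then 1 else lab (Suc i))"
      using A' Si by (metis add_Suc_right)
    have hg: "h' (Suc (r r_cnt + i)) = g (Suc i)"
      using g[OF Si] 2 le by auto
    have st: "\<forall>j<60. j \<noteq> r_budget \<longrightarrow> r' j = r j" "r' r_ptr = Suc (r r_top + i)"
      "r' r_ptr2 = Suc (r r_cnt + i)" "r' r_ctr = r r_m - i"
      "\<forall>a. a \<le> r r_top \<or> r r_top + r r_m < a \<longrightarrow> h' a = h a" "i < r r_m"
      "t' \<le> t + 15 * i + 3" using 2 by blast+
    consider (skip) "Suc i \<in> A' \<or> lab (Suc i) \<noteq> 0 \<or> g (Suc i) \<noteq> r r_level \<or> r' r_budget = 0"
      | (add) "Suc i \<notin> A'" "lab (Suc i) = 0" "g (Suc i) = r r_level" "r' r_budget > 0"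
      by auto
    then show ?case
    proof cases
      case skip
      have "P (Suc i) = P i" if "r' r_budget > 0"
      proof -
        have "A' = P i" using inv' that by (simp add: greedy_inv_def)
        then have "Suc i \<notin> F \<or> g (Suc i) \<noteq> r r_level"
          using skip that by (auto simp: F P_def)
        then show ?thesis by (auto simp: P_def le_Suc_eq)
      qed
      then have "greedy_inv F g b0 (P (Suc i)) A' (r' r_budget)"
        using inv' by (auto simp: greedy_inv_def)
      then have ex: "\<exists>A'. (\<forall>j\<in>{1..r r_m}. h' (r r_top + j) = (if j \<in> A' then 1 else lab j)) \<and>
          greedy_inv F g b0 (P (Suc i)) A' (r' r_budget)"
        using A' by blast
      have "h' (Suc (r r_top + i)) \<noteq> 0 \<or> g (Suc i) \<noteq> r r_level \<or> r' r_budget = 0"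
        using skip hA by auto
      then show ?thesis using st regs hg ex by (elim disjE) simp_all
    next
      case add
      have SF: "Suc i \<in> F" using add Si by (simp add: F)
      have "P (Suc i) = insert (Suc i) (P i)" using add SF by (auto simp: P_def le_Suc_eq)
      moreover have "greedy_inv F g b0 (insert (Suc i) (P i)) (insert (Suc i) A') (r' r_budget - 1)"
        by (rule greedy_inv_add[OF inv' finF SF]) (use add in \<open>auto simp: P_def\<close>)
      moreover have "\<forall>j\<in>{1..r r_m}. (h'(Suc (r r_top + i) := Suc 0)) (r r_top + j) =
          (if j \<in> insert (Suc i) A' then 1 else lab j)"
        using A' by auto
      ultimately have ex: "\<exists>A'. (\<forall>j\<in>{1..r r_m}. (h'(Suc (r r_top + i) := Suc 0)) (r r_top + j) =
          (if j \<in> A' then 1 else lab j)) \<and> greedy_inv F g b0 (P (Suc i)) A' (r' r_budget - Suc 0)"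
        by (metis One_nat_def)
      have "h' (Suc (r r_top + i)) = 0" using add hA by simp
      then show ?thesis using st regs hg add ex by auto
    qed
  next
    case (3 r' h' t')
    have "P (r r_m) = {f \<in> F. r r_level \<le> g f}" unfolding P_def F by auto
    then show ?case using 3 by (auto intro!: Q)
  qed
qed

definition greedy :: ram where
  "greedy = ADD r_level r_n r_zero ;;
     WHILENZ r_level (greedy_round ;; SUB r_level r_level r_one)"

lemma wp_greedy:
  assumes regs: "r r_one = 1" "r r_zero = 0"
    and g: "\<And>j. j \<in> {1..r r_m} \<Longrightarrow> h (r r_cnt + j) = g j"
    and g_le: "\<And>j. j \<in> {1..r r_m} \<Longrightarrow> g j \<le> r r_n"
    and le: "r r_cnt + r r_m \<le> r r_top"
    and F: "F = {j \<in> {1..r r_m}. h (r r_top + j) = 0}"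
    and Q: "\<And>r' h' t' A. \<forall>i<60. i \<noteq> r_budget \<longrightarrow> i \<noteq> r_level \<longrightarrow> r' i = r i \<Longrightarrow>
      \<forall>a. a \<le> r r_top \<or> r r_top + r r_m < a \<longrightarrow> h' a = h a \<Longrightarrow>
      \<forall>j\<in>{1..r r_m}. h' (r r_top + j) = (if j \<in> A then 1 else h (r r_top + j)) \<Longrightarrow>
      A \<subseteq> F \<Longrightarrow> card A \<le> r r_budget \<Longrightarrow>
      (\<And>S. S \<subseteq> F \<Longrightarrow> card S \<le> r r_budget \<Longrightarrow> sum g S \<le> sum g A) \<Longrightarrow>
      t' \<le> t + r r_n * (15 * r r_m + 6) + 2 \<Longrightarrow> Q r' h' t'"
  shows "wp greedy Q r h t"
  unfolding greedy_def wp_SEQ wp_ADD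
proof (rule wp_while[where N = "r r_n" and Inv = "\<lambda>i r' h' t'.
    (\<forall>j<60. j \<noteq> r_budget \<longrightarrow> j \<noteq> r_level \<longrightarrow> r' j = r j) \<and> r' r_level = r r_n - i \<and>
    (\<forall>a. a \<le> r r_top \<or> r r_top + r r_m < a \<longrightarrow> h' a = h a) \<and>
    (\<exists>A. (\<forall>j\<in>{1..r r_m}. h' (r r_top + j) = (if j \<in> A then 1 else h (r r_top + j))) \<and>
      greedy_inv F g (r r_budget) {f \<in> F. r r_n - i < g f} A (r' r_budget)) \<and>
    t' \<le> t + i * (15 * r r_m + 6) + 1"], goal_cases)
  case 1
  have "{f \<in> F. r r_n < g f} = {}" using g_le by (force simp: F)
  then show ?case using regs
    by (auto intro!: exI[of _ "{}"] simp: greedy_inv_def)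
next
  case (2 i r' h' t')
  then obtain A where A: "\<forall>j\<in>{1..r r_m}. h' (r r_top + j) = (if j \<in> A then 1 else h (r r_top + j))"
    and inv: "greedy_inv F g (r r_budget) {f \<in> F. r r_n - i < g f} A (r' r_budget)" by blast
  have frame: "\<forall>j<60. j \<noteq> r_budget \<longrightarrow> j \<noteq> r_level \<longrightarrow> r' j = r j" using 2 by blast
  have "wp greedy_round (wp (SUB r_level r_level r_one) (\<lambda>r' h' t'.
    (\<forall>j<60. j \<noteq> r_budget \<longrightarrow> j \<noteq> r_level \<longrightarrow> r' j = r j) \<and> r' r_level = r r_n - Suc i \<and>
    (\<forall>a. a \<le> r r_top \<or> r r_top + r r_m < a \<longrightarrow> h' a = h a) \<and>
    (\<exists>A. (\<forall>j\<in>{1..r r_m}. h' (r r_top + j) = (if j \<in> A then 1 else h (r r_top + j))) \<and>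
      greedy_inv F g (r r_budget) {f \<in> F. r r_n - Suc i < g f} A (r' r_budget)) \<and>
    t' \<le> t + Suc i * (15 * r r_m + 6) + 1)) r' h' (Suc t')"
  proof (rule wp_greedy_round[where g = g and F = F and A = A and
        lab = "\<lambda>j. h (r r_top + j)" and ?b0.0 = "r r_budget"], goal_cases)
    case (8 r2 h2 t2 A2)
    have "{f \<in> F. r r_n - Suc i < g f} = {f \<in> F. r r_n - i \<le> g f}" using 2 by auto
    then show ?case using 8 2 frame regs by (auto intro!: exI[of _ A2])
  qed (use 2 frame regs A inv g le F in auto)
  then show ?case using 2 by simp
next
  case (3 r' h' t')
  then obtain A where A: "\<forall>j\<in>{1..r r_m}. h' (r r_top + j) = (if j \<in> A then 1 else h (r r_top + j))"
    and inv: "greedy_inv F g (r r_budget) {f \<in> F. 0 < g f} A (r' r_budget)" by auto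
  have "finite F" by (simp add: F)
  note opt = greedy_inv_optimal[OF inv this]
  have "Q r' h' (Suc t')"
    by (rule Q[OF _ _ A _ _ opt]) (use 3 inv in \<open>simp_all add: greedy_inv_def, linarith?\<close>)
  then show ?case using 3 by simp
qed

definition comm :: "(nat \<Rightarrow> nat) \<Rightarrow> nat \<Rightarrow> nat \<Rightarrow> nat set" where
  "comm h a m = {j \<in> {1..m}. h (a + j) = 1}"

lemma comm_0 [simp]: "comm h a 0 = {}"
  by (simp add: comm_def)

lemma comm_Suc:
  "comm h a (Suc i) = (if h (Suc (a + i)) = 1 then insert (Suc i) (comm h a i) else comm h a i)"
  by (auto simp: comm_def le_Suc_eq)

lemma finite_comm [simp]: "finite (comm h a m)"
  by (simp add: comm_def)

lemma Suc_notin_comm [simp]: "Suc i \<notin> comm h a i"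
  by (simp add: comm_def)

lemma comm_cong:
  assumes "\<And>j. j \<in> {1..m} \<Longrightarrow> h (a + j) = h' (a' + j)"
  shows "comm h a m = comm h' a' m"
  using assms by (auto simp: comm_def)

definition finish :: ram where
  "finish = ADD r_ptr r_top r_one ;; ADD r_ptr2 r_cnt r_one ;; ADD r_ctr r_m r_zero ;;
     SETC r_size 0 ;; SETC r_score 0 ;; WHILENZ r_ctr
     (LOAD r_a r_ptr ;; SUB r_b r_a r_one ;;
      IFNZ r_b (STORE r_ptr r_zero)
        (IFNZ r_a
          (ADD r_size r_size r_one ;; LOAD r_b r_ptr2 ;; ADD r_score r_score r_b) SKIP) ;;
      ADD r_ptr r_ptr r_one ;; ADD r_ptr2 r_ptr2 r_one ;; SUB r_ctr r_ctr r_one)"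

lemma wp_finish:
  assumes regs: "r r_one = 1" "r r_zero = 0"
    and le: "r r_cnt + r r_m \<le> r r_top"
    and Q: "\<And>r' h' t'. \<forall>i<60. i \<noteq> r_size \<longrightarrow> i \<noteq> r_score \<longrightarrow> r' i = r i \<Longrightarrow>
      \<forall>a. a \<le> r r_top \<or> r r_top + r r_m < a \<longrightarrow> h' a = h a \<Longrightarrow>
      \<forall>j\<in>{1..r r_m}. h' (r r_top + j) = (if h (r r_top + j) = 1 then 1 else 0) \<Longrightarrow>
      r' r_size = card (comm h (r r_top) (r r_m)) \<Longrightarrow>
      r' r_score = (\<Sum>j\<in>comm h (r r_top) (r r_m). h (r r_cnt + j)) \<Longrightarrow>
      t' \<le> t + 12 * r r_m + 6 \<Longrightarrow> Q r' h' t'"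
  shows "wp finish Q r h t"
  unfolding finish_def wp_SEQ wp_ADD wp_SETC
proof (rule wp_while[where N = "r r_m" and Inv = "\<lambda>i r' h' t'.
    (\<forall>j<60. j \<noteq> r_size \<longrightarrow> j \<noteq> r_score \<longrightarrow> r' j = r j) \<and> r' r_ptr = Suc (r r_top + i) \<and>
    r' r_ptr2 = Suc (r r_cnt + i) \<and> r' r_ctr = r r_m - i \<and>
    (\<forall>a. a \<le> r r_top \<or> r r_top + i < a \<longrightarrow> h' a = h a) \<and>
    (\<forall>j\<in>{1..i}. h' (r r_top + j) = (if h (r r_top + j) = 1 then 1 else 0)) \<and>
    r' r_size = card (comm h (r r_top) i) \<and>
    r' r_score = (\<Sum>j\<in>comm h (r r_top) i. h (r r_cnt + j)) \<and>
    t' \<le> t + 12 * i + 5"], goal_cases)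
  case 1
  then show ?case using regs by simp
next
  case (2 i r' h' t')
  have "h' (Suc (r r_top + i)) = h (Suc (r r_top + i))" using 2 by simp
  moreover have "h' (Suc (r r_cnt + i)) = h (Suc (r r_cnt + i))" using 2 le by simp
  moreover have "h (Suc (r r_top + i)) = 0 \<or> h (Suc (r r_top + i)) = 1 \<or>
    h (Suc (r r_top + i)) > 1" by auto
  ultimately show ?case using 2 regs by (auto simp: comm_Suc le_Suc_eq)
next
  case (3 r' h' t')
  then show ?case by (auto intro!: Q)
qed

definition distance :: ram where
  "distance = ADD r_ptr r_top r_one ;; ADD r_ptr2 r_rec r_one ;; ADD r_ctr r_m r_zero ;;
     SETC r_dist 0 ;; WHILENZ r_ctr
     (LOAD r_a r_ptr ;; LOAD r_b r_ptr2 ;; SUB r_c r_a r_b ;; SUB r_d r_b r_a ;;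
      ADD r_dist r_dist r_c ;; ADD r_dist r_dist r_d ;;
      ADD r_ptr r_ptr r_one ;; ADD r_ptr2 r_ptr2 r_one ;; SUB r_ctr r_ctr r_one)"

lemma wp_distance:
  assumes regs: "r r_one = 1" "r r_zero = 0"
    and bits: "\<And>j. j \<in> {1..r r_m} \<Longrightarrow> h (r r_top + j) \<le> 1"
      "\<And>j. j \<in> {1..r r_m} \<Longrightarrow> h (r r_rec + j) \<le> 1"
    and Q: "\<And>r' t'. \<forall>i<60. i \<noteq> r_dist \<longrightarrow> r' i = r i \<Longrightarrow>
      r' r_dist = card (sym_diff (comm h (r r_rec) (r r_m)) (comm h (r r_top) (r r_m))) \<Longrightarrow>
      t' \<le> t + 10 * r r_m + 5 \<Longrightarrow> Q r' h t'"
  shows "wp distance Q r h t"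
  unfolding distance_def wp_SEQ wp_ADD wp_SETC
proof (rule wp_while[where N = "r r_m" and Inv = "\<lambda>i r' h' t'.
    (\<forall>j<60. j \<noteq> r_dist \<longrightarrow> r' j = r j) \<and> r' r_ptr = Suc (r r_top + i) \<and>
    r' r_ptr2 = Suc (r r_rec + i) \<and> r' r_ctr = r r_m - i \<and> h' = h \<and>
    r' r_dist = card (sym_diff (comm h (r r_rec) i) (comm h (r r_top) i)) \<and>
    t' \<le> t + 10 * i + 4"], goal_cases)
  case 1
  then show ?case using regs by simp
next
  case (2 i r' h' t')
  have "h (r r_top + Suc i) \<le> 1" "h (r r_rec + Suc i) \<le> 1" 
    using bits(1)[of "Suc i"] bits(2)[of "Suc i"] 2 by simp_all
  then have "h (Suc (r r_top + i)) = 0 \<or> h (Suc (r r_top + i)) = 1"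
    "h (Suc (r r_rec + i)) = 0 \<or> h (Suc (r r_rec + i)) = 1" by auto
  then show ?case using 2 regs
    by (auto simp: comm_Suc insert_Diff_if)
next
  case (3 r' h' t')
  then show ?case by (auto intro!: Q)
qed

definition link :: ram where
  "link = ADD r_found r_first r_zero ;; ADD r_rec r_prev r_zero ;; SUB r_rem r_cur r_prev ;;
     WHILENZ r_rem
     (distance ;; SUB r_a r_l r_dist ;; IFNZ r_a SKIP (SETC r_found 1) ;;
      ADD r_rec r_rec r_m ;; SUB r_rem r_rem r_m)"

lemma wp_link:
  assumes regs: "r r_one = 1" "r r_zero = 0" and m: "r r_m > 0"
    and cur: "r r_cur = r r_prev + N * r r_m"
    and bits: "\<And>j. j \<in> {1..r r_m} \<Longrightarrow> h (r r_top + j) \<le> 1"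
      "\<And>i j. i < N \<Longrightarrow> j \<in> {1..r r_m} \<Longrightarrow> h (r r_prev + i * r r_m + j) \<le> 1"
    and Q: "\<And>r' t'. \<forall>i<54. r' i = r i \<Longrightarrow>
      (r' r_found \<noteq> 0 \<longleftrightarrow> r r_first \<noteq> 0 \<or> (\<exists>i<N. r r_l \<le>
        card (sym_diff (comm h (r r_prev + i * r r_m) (r r_m)) (comm h (r r_top) (r r_m))))) \<Longrightarrow>
      t' \<le> t + N * (10 * r r_m + 11) + 4 \<Longrightarrow> Q r' h t'"
  shows "wp link Q r h t"
  unfolding link_def wp_SEQ wp_ADD wp_SUB
proof (rule wp_while[where N = N and Inv = "\<lambda>i r' h' t'.
    (\<forall>j<54. r' j = r j) \<and> r' r_rec = r r_prev + i * r r_m \<and> r' r_rem = (N - i) * r r_m \<and>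
    h' = h \<and> (r' r_found \<noteq> 0 \<longleftrightarrow> r r_first \<noteq> 0 \<or> (\<exists>i'<i. r r_l \<le>
        card (sym_diff (comm h (r r_prev + i' * r r_m) (r r_m)) (comm h (r r_top) (r r_m))))) \<and>
    t' \<le> t + i * (10 * r r_m + 11) + 3"], goal_cases)
  case 1
  then show ?case using regs cur by simp
next
  case (2 i r' h' t')
  have nz: "r' r_rem \<noteq> 0" using 2 m by simp
  have rem: "(N - i) * r r_m - r r_m = (N - Suc i) * r r_m"
    by (metis diff_Suc_eq_diff_pred diff_mult_distrib mult.left_neutral diff_commute One_nat_def)
  have ex: "(\<exists>i'<Suc i. R i') \<longleftrightarrow> (\<exists>i'<i. R i') \<or> R i" for R
    using less_Suc_eq by auto
  show ?case
    unfolding wp_SEQ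
  proof (intro conjI nz, rule wp_distance, goal_cases)
    case (5 r2 t2)
    have fr: "\<forall>j<54. r2 j = r j" "r2 r_rec = r r_prev + i * r r_m" "r2 r_rem = (N - i) * r r_m"
      "r2 r_found = r' r_found"
      using 5(1) 2(2) by auto
    have d: "r2 r_dist = card (sym_diff (comm h (r r_prev + i * r r_m) (r r_m)) (comm h (r r_top) (r r_m)))"
      using 5(2) 2(2) by simp
    show ?case using fr d 2(2) 5(3) rem unfolding ex by (auto simp: algebra_simps)
  qed (use 2 regs bits in auto)
next
  case (3 r' h' t')
  then show ?case by (auto intro!: Q)
qed

definition advance :: ram where
  "advance = ADD r_ptr r_word r_zero ;; ADD r_ctr r_L r_zero ;; SETC r_carry 1 ;;
     WHILENZ r_ctr
     (IFNZ r_carry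
        (LOAD r_a r_ptr ;; SUB r_b r_m r_a ;;
         IFNZ r_b
           (ADD r_a r_a r_one ;; STORE r_ptr r_a ;; SETC r_carry 0)
           (STORE r_ptr r_one))
        SKIP ;;
      ADD r_ptr r_ptr r_one ;; SUB r_ctr r_ctr r_one)"

definition word_val :: "nat \<Rightarrow> nat \<Rightarrow> (nat \<Rightarrow> nat) \<Rightarrow> nat" where
  "word_val m i d = (\<Sum>j<i. (d j - 1) * m ^ j)"

lemma wp_advance:
  assumes regs: "r r_one = 1" "r r_zero = 0"
    and word: "\<And>i. i < r r_L \<Longrightarrow> h (r r_word + i) \<in> {1..r r_m}"
    and Q: "\<And>r' h' t'. \<forall>i<58. r' i = r i \<Longrightarrow>
      \<forall>a. a < r r_word \<or> r r_word + r r_L \<le> a \<longrightarrow> h' a = h a \<Longrightarrow>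
      \<forall>i<r r_L. h' (r r_word + i) \<in> {1..r r_m} \<Longrightarrow> r' r_carry \<le> 1 \<Longrightarrow>
      word_val (r r_m) (r r_L) (\<lambda>i. h' (r r_word + i)) + r' r_carry * r r_m ^ r r_L =
        Suc (word_val (r r_m) (r r_L) (\<lambda>i. h (r r_word + i))) \<Longrightarrow>
      t' \<le> t + 10 * r r_L + 4 \<Longrightarrow> Q r' h' t'"
  shows "wp advance Q r h t"
  unfolding advance_def wp_SEQ wp_ADD wp_SETC
proof (rule wp_while[where N = "r r_L" and Inv = "\<lambda>i r' h' t'.
    (\<forall>j<58. r' j = r j) \<and> r' r_ptr = r r_word + i \<and> r' r_ctr = r r_L - i \<and>
    (\<forall>a. a < r r_word \<or> r r_word + i \<le> a \<longrightarrow> h' a = h a) \<and>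
    (\<forall>j<i. h' (r r_word + j) \<in> {1..r r_m}) \<and> r' r_carry \<le> 1 \<and>
    word_val (r r_m) i (\<lambda>i. h' (r r_word + i)) + r' r_carry * r r_m ^ i =
        Suc (word_val (r r_m) i (\<lambda>i. h (r r_word + i))) \<and>
    t' \<le> t + 10 * i + 3"], goal_cases)
  case 1
  then show ?case using regs by (simp add: word_val_def)
next
  case (2 i r' h' t')
  have hi: "h' (r r_word + i) = h (r r_word + i)" "h (r r_word + i) \<in> {1..r r_m}"
    using 2 word by auto
  have wv: "word_val m i (\<lambda>j. if j = i then c else f j) = word_val m i f" for m c f
    by (simp add: word_val_def)
  have wS: "word_val m (Suc i) d = word_val m i d + (d i - 1) * m ^ i" for m d
    by (simp add: word_val_def)
  consider (nocarry) "r' r_carry = 0" | (inc) "r' r_carry = 1" "h (r r_word + i) < r r_m"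
    | (ov) "r' r_carry = 1" "h (r r_word + i) = r r_m"
    using 2 hi by fastforce
  then show ?case
  proof cases
    case nocarry
    then show ?thesis using 2 regs hi by (auto simp: wS less_Suc_eq)
  next
    case inc
    obtain e where e: "h (r r_word + i) = Suc e" using hi by (cases "h (r r_word + i)") auto
    then show ?thesis using 2 regs hi inc
      by (auto simp: wS wv less_Suc_eq)
  next
    case ov
    obtain e where e: "r r_m = Suc e" using hi by (cases "r r_m") auto
    then show ?thesis using 2 regs hi ov
      by (auto simp: wS wv less_Suc_eq)
  qed
next
  case (3 r' h' t')
  then show ?case by (auto intro!: Q)
qed

lemma word_val_less:
  assumes "\<And>j. j < i \<Longrightarrow> d j \<in> {1..m}"
  shows "word_val m i d < m ^ i"
  using assms
proof (induction i)
  case 0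
  then show ?case by (simp add: word_val_def)
next
  case (Suc i)
  have "d i \<in> {1..m}" using Suc.prems by simp
  then obtain e where e: "d i = Suc e" "Suc e \<le> m" by (cases "d i") auto
  have "word_val m (Suc i) d = word_val m i d + e * m ^ i" by (simp add: word_val_def e)
  also have "\<dots> < Suc e * m ^ i" using Suc by simp
  also have "\<dots> \<le> m * m ^ i" using e(2) by (rule mult_le_mono1)
  finally show ?case by simp
qed

lemma word_val_inj:
  assumes "\<And>j. j < i \<Longrightarrow> d j \<in> {1..m}" "\<And>j. j < i \<Longrightarrow> d' j \<in> {1..m}"
    and "word_val m i d = word_val m i d'" "j < i"
  shows "d j = d' j"
  using assms
proof (induction i)
  case 0
  then show ?case by simp
next
  case (Suc i)
  have lt: "word_val m i d < m ^ i" "word_val m i d' < m ^ i"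
    using Suc.prems by (auto intro!: word_val_less)
  have eq: "word_val m i d + (d i - 1) * m ^ i = word_val m i d' + (d' i - 1) * m ^ i"
    using Suc.prems(3) by (simp add: word_val_def)
  have "m ^ i \<noteq> 0" using lt(1) by linarith
  then have "d i - 1 = d' i - 1"
    using arg_cong[OF eq, of "\<lambda>v. v div m ^ i"] lt by simp
  moreover have "word_val m i d = word_val m i d'"
    using arg_cong[OF eq, of "\<lambda>v. v mod m ^ i"] lt by simp
  moreover have "d i \<ge> 1" "d' i \<ge> 1" using Suc.prems(1,2)[of i] by auto
  ultimately have "d i = d' i" "word_val m i d = word_val m i d'" by linarith+
  then show ?case using Suc by (cases "j = i") auto
qed

section \<open>One stage\<close>

text \<open>\<open>N\<close> records of the previous stage and \<open>M\<close> of the current stage are stored in the cells after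
  \<open>r_prev\<close>; the record with base address \<open>a\<close> occupies the cells \<open>a + 1, \<dots>, a + m\<close>.\<close>

definition layout :: "nat \<Rightarrow> nat \<Rightarrow> (nat \<Rightarrow> nat) \<Rightarrow> (nat \<Rightarrow> nat) \<Rightarrow> bool" where
  "layout N M r h \<longleftrightarrow> r r_one = 1 \<and> r r_two = 2 \<and> r r_zero = 0 \<and> 0 < r r_m \<and>
     r r_cnt + r r_m < r r_word \<and> r r_word + r r_L \<le> r r_prev \<and>
     r r_cur = r r_prev + N * r r_m \<and> r r_top = r r_cur + M * r r_m \<and>
     (\<forall>c. r r_prev < c \<and> c \<le> r r_top \<longrightarrow> h c \<le> 1)"

definition counts :: "(nat \<Rightarrow> nat) \<Rightarrow> (nat \<Rightarrow> nat) \<Rightarrow> (nat \<Rightarrow> nat) \<Rightarrow> bool" where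
  "counts g r h \<longleftrightarrow> (\<forall>j\<in>{1..r r_m}. h (r r_cnt + j) = g j \<and> g j \<le> r r_n)"

definition digits :: "(nat \<Rightarrow> nat) \<Rightarrow> (nat \<Rightarrow> nat) \<Rightarrow> bool" where
  "digits r h \<longleftrightarrow> (\<forall>i<r r_L. h (r r_word + i) \<in> {1..r r_m})"

definition recs :: "(nat \<Rightarrow> nat) \<Rightarrow> nat \<Rightarrow> nat \<Rightarrow> nat \<Rightarrow> nat set set" where
  "recs h a N m = (\<lambda>i. comm h (a + i * m) m) ` {..<N}"

lemma recs_0 [simp]: "recs h a 0 m = {}"
  by (simp add: recs_def)

lemma recs_Suc: "recs h a (Suc N) m = insert (comm h (a + N * m) m) (recs h a N m)"
  by (simp add: recs_def lessThan_Suc)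

lemma record_bound:
  fixes i j m N :: nat
  assumes "i < N" "j \<le> m"
  shows "i * m + j \<le> N * m"
proof -
  have "i * m + j \<le> Suc i * m" using assms by simp
  also have "\<dots> \<le> N * m" using assms by (intro mult_le_mono1) simp
  finally show ?thesis .
qed

lemma recs_cong:
  assumes "\<And>c. a < c \<Longrightarrow> c \<le> a + N * m \<Longrightarrow> h' c = h c"
  shows "recs h' a N m = recs h a N m"
  unfolding recs_def
proof (rule image_cong[OF refl], rule comm_cong)
  fix i j assume "i \<in> {..<N}" "j \<in> {1..m}"
  then show "h' (a + i * m + j) = h (a + i * m + j)"
    using record_bound[of i N j m] by (intro assms) auto
qed

definition accept ::
  "(nat \<Rightarrow> nat) \<Rightarrow> (nat \<Rightarrow> nat) \<Rightarrow> nat set set \<Rightarrow> nat set \<Rightarrow> bool" where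
  "accept r g P G \<longleftrightarrow> G \<subseteq> {1..r r_m} \<and> card G \<le> r r_k \<and> r r_x \<le> sum g G \<and>
     (r r_first \<noteq> 0 \<or> (\<exists>p\<in>P. r r_l \<le> card (sym_diff p G)))"

definition covers ::
  "nat \<Rightarrow> (nat \<Rightarrow> nat) \<Rightarrow> nat \<Rightarrow> nat set \<Rightarrow> nat set \<Rightarrow> nat set \<Rightarrow> bool" where
  "covers m g k X Y G \<longleftrightarrow> (X \<inter> Y = {} \<longrightarrow> card X \<le> k \<longrightarrow>
     G \<subseteq> {1..m} \<and> X \<subseteq> G \<and> G \<inter> Y = {} \<and> card G \<le> k \<and>
     (\<forall>S\<subseteq>{1..m}. X \<subseteq> S \<longrightarrow> S \<inter> Y = {} \<longrightarrow> card S \<le> k \<longrightarrow> sum g S \<le> sum g G))"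

definition handled ::
  "(nat \<Rightarrow> nat) \<Rightarrow> (nat \<Rightarrow> nat) \<Rightarrow> nat set set \<Rightarrow> nat set set \<Rightarrow> nat set \<Rightarrow> nat set \<Rightarrow> bool" where
  "handled r g P S X Y \<longleftrightarrow> (\<exists>G. covers (r r_m) g (r r_k) X Y G \<and> (accept r g P G \<longrightarrow> G \<in> S))"

lemma accept_frame:
  assumes "\<forall>i<r_qs. r' i = r i"
  shows "accept r' g P G = accept r g P G"
  using assms by (simp add: accept_def)

lemma handled_frame:
  assumes "\<forall>i<r_qs. r' i = r i"
  shows "handled r' g P S X Y = handled r g P S X Y"
  using assms by (simp add: handled_def accept_frame[OF assms])

lemma handled_mono:
  assumes "handled r g P S X Y" "S \<subseteq> S'"
  shows "handled r g P S' X Y"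
  using assms by (auto simp: handled_def)

definition log_inv ::
  "(nat \<Rightarrow> nat) \<Rightarrow> nat \<Rightarrow> nat set set \<Rightarrow> nat \<Rightarrow> nat set set \<Rightarrow> (nat \<Rightarrow> nat) \<Rightarrow> (nat \<Rightarrow> nat) \<Rightarrow> bool" where
  "log_inv g N P B S r h \<longleftrightarrow> counts g r h \<and> recs h (r r_prev) N (r r_m) = P \<and>
     (\<forall>G\<in>S. accept r g P G) \<and>
     (\<exists>M\<le>B. layout N M r h \<and> recs h (r r_cur) M (r r_m) = S)"

lemma log_inv_frame:
  assumes "log_inv g N P B S r h"
    and "\<forall>i<r_qs. r' i = r i" "r' r_top = r r_top"
    and "\<forall>a. a < r r_word \<or> r r_word + r r_L \<le> a \<longrightarrow> h' a = h a"
  shows "log_inv g N P B S r' h'"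
proof -
  from assms(1) obtain M where M: "M \<le> B" "layout N M r h" "recs h (r r_cur) M (r r_m) = S"
    by (auto simp: log_inv_def)
  have h: "h' c = h c" if "c > r r_prev" for c
    using assms(4) M(2) that by (auto simp: layout_def)
  have "recs h' (r r_prev) N (r r_m) = recs h (r r_prev) N (r r_m)"
    by (rule recs_cong) (simp add: h)
  moreover have "recs h' (r r_cur) M (r r_m) = recs h (r r_cur) M (r r_m)"
    by (rule recs_cong) (use M(2) in \<open>auto simp: h layout_def\<close>)
  moreover have "layout N M r' h'"
    using M(2) assms(2,3) h by (simp add: layout_def)
  moreover have "counts g r' h'"
    using assms M(2) by (auto simp: counts_def log_inv_def layout_def)
  ultimately show ?thesis
    using assms(1) M accept_frame[OF assms(2)] assms(2) by (auto simp: log_inv_def)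
qed

lemma covers_greedy:
  assumes X: "X \<subseteq> {1..m}"
    and A: "A \<subseteq> {1..m} - X - Y" "card A \<le> k - card X"
    and opt: "\<And>S. S \<subseteq> {1..m} - X - Y \<Longrightarrow> card S \<le> k - card X \<Longrightarrow> sum g S \<le> sum g A"
  shows "covers m g k X Y (A \<union> (X - Y))"
  unfolding covers_def
proof (intro impI)
  assume disj: "X \<inter> Y = {}" and k: "card X \<le> k"
  then have XY: "X - Y = X" by auto
  have fin: "finite A" "finite X" using X A finite_subset by blast+
  have AX: "A \<inter> X = {}" using A by auto
  have card: "card (A \<union> X) = card A + card X" using fin AX by (simp add: card_Un_disjoint)
  have opt': "sum g S \<le> sum g (A \<union> X)"
    if S: "S \<subseteq> {1..m}" "X \<subseteq> S" "S \<inter> Y = {}" "card S \<le> k" for S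
  proof -
    have finS: "finite S" using S finite_subset by blast
    have "sum g (S - X) \<le> sum g A"
      using S fin by (intro opt) (auto simp: card_Diff_subset)
    moreover have "sum g S = sum g (S - X) + sum g X"
      using finS S(2) by (simp add: sum.subset_diff)
    moreover have "sum g (A \<union> X) = sum g A + sum g X"
      using fin AX by (simp add: sum.union_disjoint)
    ultimately show ?thesis by simp
  qed
  have "card (A \<union> X) \<le> k" "A \<union> X \<subseteq> {1..m}" "(A \<union> X) \<inter> Y = {}"
    using X A disj k card by auto
  with opt' show "A \<union> (X - Y) \<subseteq> {1..m} \<and> X \<subseteq> A \<union> (X - Y) \<and> (A \<union> (X - Y)) \<inter> Y = {} \<and>
     card (A \<union> (X - Y)) \<le> k \<and>
     (\<forall>S\<subseteq>{1..m}. X \<subseteq> S \<longrightarrow> S \<inter> Y = {} \<longrightarrow> card S \<le> k \<longrightarrow> sum g S \<le> sum g (A \<union> (X - Y)))"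
    unfolding XY by simp
qed

definition try_word :: ram where
  "try_word = ADD r_ptr r_top r_one ;; ADD r_ctr r_m r_zero ;; SETC r_val 0 ;; fill ;;
     label ;; greedy ;; finish ;; link ;;
     IFNZ r_found
       (SUB r_a r_size r_k ;; IFNZ r_a SKIP
         (SUB r_a r_x r_score ;; IFNZ r_a SKIP (ADD r_top r_top r_m)))
       SKIP"

definition try_time :: "(nat \<Rightarrow> nat) \<Rightarrow> nat \<Rightarrow> nat" where
  "try_time r N = 16 * r r_m + 11 * r r_L + r r_n * (15 * r r_m + 6) + N * (10 * r r_m + 11) + 30"

lemma wp_try_word:
  assumes inv: "log_inv g N P B S r h" and dig: "digits r h" and q: "r r_q \<le> r r_L"
    and Q: "\<And>r' h' t' S'. \<forall>i<50. i \<noteq> r_top \<longrightarrow> r' i = r i \<Longrightarrow>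
      \<forall>a\<le>r r_prev. h' a = h a \<Longrightarrow> S \<subseteq> S' \<Longrightarrow> log_inv g N P (Suc B) S' r' h' \<Longrightarrow>
      handled r g P S' ((\<lambda>i. h (r r_word + i)) ` {..<r r_q})
        ((\<lambda>i. h (r r_word + i)) ` {r r_q..<r r_L}) \<Longrightarrow>
      t' \<le> t + try_time r N \<Longrightarrow> Q r' h' t'"
  shows "wp try_word Q r h t"
proof -
  from inv obtain M where M: "M \<le> B" "layout N M r h" "recs h (r r_cur) M (r r_m) = S"
    by (auto simp: log_inv_def)
  define m where "m = r r_m"
  define top where "top = r r_top"
  define d where "d = (\<lambda>i. h (r r_word + i))"
  define X where "X = d ` {..<r r_q}"
  define Y where "Y = d ` {r r_q..<r r_L}"
  have lay: "r r_one = 1" "r r_two = 2" "r r_zero = 0" "0 < m" "r r_cnt + m < r r_word"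
    "r r_word + r r_L \<le> r r_prev" "r r_cur = r r_prev + N * m" "top = r r_cur + M * m"
    "\<forall>c. r r_prev < c \<and> c \<le> top \<longrightarrow> h c \<le> 1" "r r_m = m" "r r_top = top"
    using M(2) by (auto simp: layout_def m_def top_def)
  have g: "\<forall>j\<in>{1..m}. h (r r_cnt + j) = g j \<and> g j \<le> r r_n"
    using inv by (simp add: log_inv_def counts_def m_def)
  have cnt_top: "r r_cnt + m < top" "r r_prev \<le> top" using lay(5-8) by linarith+
  have dd: "\<forall>i<r r_L. d i \<in> {1..m}" using dig by (simp add: digits_def d_def m_def)
  have XY: "X \<subseteq> {1..m}" "Y \<subseteq> {1..m}" using dd q by (auto simp: X_def Y_def)
  show ?thesis
    unfolding try_word_def wp_SEQ wp_ADD wp_SETC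
  proof (rule wp_fill, goal_cases)
    case 1
    then show ?case using lay by simp
  next
    case (2 r1 h1 t1)
    have r1: "\<forall>i<60. r1 i = r i" using 2(1) by simp
    have h1: "\<forall>a. a \<le> top \<or> top + m < a \<longrightarrow> h1 a = h a" "\<forall>j\<in>{1..m}. h1 (top + j) = 0"
      using 2(2) lay by auto
    have t1: "t1 \<le> t + 4 * m + 4" using 2(3) lay by simp
    have d1: "(\<lambda>i. h1 (r r_word + i)) ` {..<r r_q} = X"
      "(\<lambda>i. h1 (r r_word + i)) ` {r r_q..<r r_L} = Y"
      unfolding X_def Y_def d_def using h1(1) lay q by (auto intro!: image_cong)
    show ?case
    proof (rule wp_label, goal_cases)
      case (5 i)
      then have "i < r r_L" using r1 by simp
      then have "h1 (r r_word + i) = d i" using h1(1) lay by (simp add: d_def)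
      then show ?case using r1 lay dd \<open>i < r r_L\<close> by simp
    next
      case (8 r2 h2 t2)
      have r2: "\<forall>i<60. i \<noteq> r_budget \<longrightarrow> r2 i = r i" using 8(1) r1 by simp
      have bud: "r2 r_budget = r r_k - card X" using 8(2) r1 d1 by simp
      have h2: "\<forall>a. a \<le> top \<or> top + m < a \<longrightarrow> h2 a = h a" using 8(3) r1 h1 lay by simp
      have lab: "\<forall>j\<in>{1..m}. h2 (top + j) = (if j \<in> Y then 2 else if j \<in> X then 1 else 0)"
        using 8(4) r1 lay d1 by simp
      have t2: "t2 \<le> t + 4 * m + 11 * r r_L + 9" using 8(5) t1 r1 lay by simp
      have F: "{j \<in> {1..m}. h2 (top + j) = 0} = {1..m} - X - Y"
      proof -
        have "h2 (top + j) = 0 \<longleftrightarrow> j \<notin> X \<and> j \<notin> Y" if "j \<in> {1..m}" for j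
          using bspec[OF lab that] by simp
        then show ?thesis by auto
      qed
      show ?case
      proof (rule wp_greedy[where g = g and F = "{1..m} - X - Y"], goal_cases)
        case (7 r3 h3 t3 A)
        have r3: "\<forall>i<60. i \<noteq> r_budget \<longrightarrow> i \<noteq> r_level \<longrightarrow> r3 i = r i" using 7(1) r2 by simp
        have h3: "\<forall>a. a \<le> top \<or> top + m < a \<longrightarrow> h3 a = h a" using 7(2) r2 h2 lay by simp
        have lab3: "\<forall>j\<in>{1..m}. h3 (top + j) = (if j \<in> A then 1 else h2 (top + j))"
          using 7(3) r2 lay by simp
        have A: "A \<subseteq> {1..m} - X - Y" "card A \<le> r r_k - card X"
          "\<And>S. S \<subseteq> {1..m} - X - Y \<Longrightarrow> card S \<le> r r_k - card X \<Longrightarrow> sum g S \<le> sum g A"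
          using 7(4-6) bud by auto
        have t3: "t3 \<le> t + 4 * m + 11 * r r_L + r r_n * (15 * m + 6) + 11"
          using 7(7) t2 r2 lay by simp
        define G where "G = A \<union> (X - Y)"
        have cG: "covers m g (r r_k) X Y G"
          unfolding G_def by (rule covers_greedy) (use XY A in auto)
        have G3: "comm h3 top m = G"
          using lab3 lab A(1) XY by (auto simp: comm_def G_def split: if_splits)
        have Gm: "G \<subseteq> {1..m}" using A(1) XY by (auto simp: G_def)
        show ?case
        proof (rule wp_finish, goal_cases)
          case (4 r4 h4 t4)
          have r4: "\<forall>i<50. r4 i = r i" using 4(1) r3 by simp
          have h4: "\<forall>a. a \<le> top \<or> top + m < a \<longrightarrow> h4 a = h a" using 4(2) r3 h3 lay by simp
          have b4: "\<forall>j\<in>{1..m}. h4 (top + j) = (if h3 (top + j) = 1 then 1 else 0)"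
            using 4(3) r3 lay by simp
          have G4: "comm h4 top m = G" using b4 G3 by (auto simp: comm_def)
          have size: "r4 r_size = card G" using 4(4) r3 lay G3 by simp
          have "r4 r_score = (\<Sum>j\<in>G. h3 (r r_cnt + j))" using 4(5) r3 lay G3 by simp
          also have "\<dots> = sum g G"
            by (rule sum.cong) (use Gm h3 cnt_top g in auto)
          finally have score: "r4 r_score = sum g G" .
          have t4: "t4 \<le> t + 16 * m + 11 * r r_L + r r_n * (15 * m + 6) + 17"
            using 4(6) t3 r3 lay by simp
          have recsP: "recs h4 (r r_prev) N m = P"
          proof -
            have "recs h4 (r r_prev) N m = recs h (r r_prev) N m"
              by (rule recs_cong) (use h4 lay(7,8) in auto)
            then show ?thesis using inv by (simp add: log_inv_def m_def)
          qed
          have recsS: "recs h4 (r r_cur) M m = S"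
          proof -
            have "recs h4 (r r_cur) M m = recs h (r r_cur) M m"
              by (rule recs_cong) (use h4 lay(7,8) in auto)
            then show ?thesis using M by (simp add: m_def)
          qed
          have h4bits: "h4 c \<le> 1" if "r r_prev < c" "c \<le> top + m" for c
          proof (cases "c \<le> top")
            case True
            then show ?thesis using that h4 lay by auto
          next
            case False
            then have "c = top + (c - top)" "c - top \<in> {1..m}" using that by auto
            then show ?thesis using b4 by (metis le_refl zero_le_one)
          qed
          have cnt4: "counts g r4 h4"
            using g h4 cnt_top r4 lay by (auto simp: counts_def)
          show ?case
          proof (rule wp_link[where N = N], goal_cases)
            case (5 j)
            then show ?case using h4bits[of "top + j"] r4 lay cnt_top by auto
          next
            case (6 i j)
            then have "j \<le> m" using r4 lay by simp
            from record_bound[OF 6(1) this] 6 show ?case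
              using h4bits[of "r r_prev + i * m + j"] r4 lay by auto
          next
            case (7 r5 t5)
            have r5: "\<forall>i<50. r5 i = r i" "r5 r_size = card G" "r5 r_score = sum g G"
              using 7(1) r4 size score by auto
            have "(\<exists>i<N. r r_l \<le> card (sym_diff (comm h4 (r r_prev + i * m) m) G)) \<longleftrightarrow>
               (\<exists>p\<in>P. r r_l \<le> card (sym_diff p G))"
              unfolding recsP[symmetric] recs_def by auto
            then have found: "r5 r_found \<noteq> 0 \<longleftrightarrow>
                r r_first \<noteq> 0 \<or> (\<exists>p\<in>P. r r_l \<le> card (sym_diff p G))"
              using 7(2) r4 lay G4 by simp
            have t5: "t5 \<le> t + 16 * m + 11 * r r_L + r r_n * (15 * m + 6) + N * (10 * m + 11) + 21"
              using 7(3) t4 r4 lay by simp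
            show ?case
            proof (cases "accept r g P G")
              case True
              let ?r = "r5(r_a := 0, r_top := top + m)"
              have fr: "\<forall>i<50. i \<noteq> r_top \<longrightarrow> (r5(r_a := 0, r_top := top + m)) i = r i"
                using r5 by simp
              have "layout N (Suc M) ?r h4"
                using lay h4bits r5 by (auto simp: layout_def)
              moreover have "recs h4 (r r_cur) (Suc M) m = insert G S"
                unfolding recs_Suc using recsS G4 lay by simp
              moreover have "accept ?r g P G'" if "G' \<in> insert G S" for G'
              proof -
                have "accept r g P G'" using that True inv by (auto simp: log_inv_def)
                then show ?thesis using r5 by (simp add: accept_def)
              qed
              ultimately have "log_inv g N P (Suc B) (insert G S) ?r h4"
                using M(1) r5 cnt4 recsP r4 lay by (auto simp: log_inv_def counts_def)
              then have "Q ?r h4 (Suc (Suc (Suc (Suc (Suc (Suc t5))))))"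
                using fr h4 cnt_top cG t5 lay
                by (intro Q[where S' = "insert G S"])
                  (auto simp: handled_def try_time_def X_def Y_def d_def)
              then show ?thesis using True found r5 lay by (simp add: accept_def)
            next
              case False
              have "log_inv g N P (Suc B) S r' h4" if "\<forall>i<50. r' i = r i" for r'
                using that M inv cnt4 recsP recsS r4 lay h4bits
                by (auto simp: log_inv_def counts_def accept_def layout_def intro!: exI[of _ M])
              then have "Q r' h4 t'"
                if "\<forall>i<50. r' i = r i" "t' \<le> t5 + 6" for r' t'
                using that h4 cnt_top cG t5 lay False
                by (intro Q[where S' = S])
                  (auto simp: handled_def try_time_def X_def Y_def d_def)
              then show ?thesis using False found r5 lay Gm by (auto simp: accept_def)
            qed
          qed (use r4 lay in auto)
        qed (use r3 lay cnt_top in auto)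
      qed (use r2 lay cnt_top h2 g F in auto)
    qed (use r1 lay q cnt_top h1 in auto)
  qed
qed

definition words :: ram where
  "words = ADD r_ptr r_word r_zero ;; ADD r_ctr r_L r_zero ;; SETC r_val 1 ;; fill ;; SETC r_go 1 ;;
     WHILENZ r_go (try_word ;; advance ;; SUB r_go r_one r_carry)"

definition words_time :: "(nat \<Rightarrow> nat) \<Rightarrow> nat \<Rightarrow> nat" where
  "words_time r N = r r_m ^ r r_L * (try_time r N + 10 * r r_L + 6) + 4 * r r_L + 6"

lemma word_val_cong: "(\<And>j. j < i \<Longrightarrow> d j = d' j) \<Longrightarrow> word_val m i d = word_val m i d'"
  by (simp add: word_val_def)

lemma wp_words:
  assumes inv: "log_inv g N P B S r h" and q: "r r_q \<le> r r_L"
    and Q: "\<And>r' h' t' S'. \<forall>i<50. i \<noteq> r_top \<longrightarrow> i \<noteq> r_go \<longrightarrow> r' i = r i \<Longrightarrow>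
      \<forall>a<r r_cnt. h' a = h a \<Longrightarrow> S \<subseteq> S' \<Longrightarrow> log_inv g N P (B + r r_m ^ r r_L) S' r' h' \<Longrightarrow>
      (\<And>d. \<forall>j<r r_L. d j \<in> {1..r r_m} \<Longrightarrow>
        handled r g P S' (d ` {..<r r_q}) (d ` {r r_q..<r r_L})) \<Longrightarrow>
      t' \<le> t + words_time r N \<Longrightarrow> Q r' h' t'"
  shows "wp words Q r h t"
proof -
  define m where "m = r r_m"
  define L where "L = r r_L"
  define T where "T = try_time r N + 10 * L + 6"
  from inv obtain M where "layout N M r h" by (auto simp: log_inv_def)
  then have lay: "r r_one = 1" "r r_zero = 0" "0 < m" "r r_cnt < r r_word" "r r_word + L \<le> r r_prev"
    by (auto simp: layout_def m_def L_def)
  show ?thesis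
    unfolding words_def wp_SEQ wp_ADD wp_SETC
  proof (rule wp_fill, goal_cases)
    case 1
    then show ?case using lay by simp
  next
    case (2 r1 h1 t1)
    have r1: "\<forall>i<60. r1 i = r i" using 2(1) by simp
    have h1: "\<forall>a. a < r r_word \<or> r r_word + L \<le> a \<longrightarrow> h1 a = h a" "\<forall>i<L. h1 (r r_word + i) = 1"
      using 2(2) lay by (auto simp: L_def)
    have t1: "t1 \<le> t + 4 * L + 4" using 2(3) lay by (simp add: L_def)
    have inv1: "log_inv g N P B S (r1(r_go := 1)) h1"
      by (rule log_inv_frame[OF inv]) (use r1 h1 in \<open>auto simp: L_def\<close>)
    show ?case
      unfolding wp_SETC
    proof (rule wp_while[where N = "m ^ L" and Inv = "\<lambda>i r' h' t'.
        (\<forall>j<50. j \<noteq> r_top \<longrightarrow> j \<noteq> r_go \<longrightarrow> r' j = r j) \<and> (\<forall>a<r r_cnt. h' a = h a) \<and>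
        (\<forall>j<L. h' (r r_word + j) \<in> {1..m}) \<and>
        (i < m ^ L \<longrightarrow> r' r_go = 1 \<and> word_val m L (\<lambda>j. h' (r r_word + j)) = i) \<and>
        (i = m ^ L \<longrightarrow> r' r_go = 0) \<and>
        (\<exists>S'. S \<subseteq> S' \<and> log_inv g N P (B + i) S' r' h' \<and>
          (\<forall>d. (\<forall>j<L. d j \<in> {1..m}) \<longrightarrow> word_val m L d < i \<longrightarrow>
            handled r g P S' (d ` {..<r r_q}) (d ` {r r_q..<L}))) \<and>
        t' \<le> t + 4 * L + 5 + i * T"], goal_cases)
      case 1
      have "word_val m L (\<lambda>j. h1 (r r_word + j)) = 0" using h1(2) by (simp add: word_val_def)
      then show ?case using r1 h1 lay t1 inv1 by (auto intro!: exI[of _ S])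
    next
      case (2 i r2 h2 t2)
      then obtain S2 where S2: "S \<subseteq> S2" "log_inv g N P (B + i) S2 r2 h2"
        "\<forall>d. (\<forall>j<L. d j \<in> {1..m}) \<longrightarrow> word_val m L d < i \<longrightarrow>
            handled r g P S2 (d ` {..<r r_q}) (d ` {r r_q..<L})"
        by blast
      have r2: "\<forall>j<50. j \<noteq> r_top \<longrightarrow> j \<noteq> r_go \<longrightarrow> r2 j = r j" "r2 r_go = 1"
        and h2: "\<forall>a<r r_cnt. h2 a = h a" "\<forall>j<L. h2 (r r_word + j) \<in> {1..m}"
        and val: "word_val m L (\<lambda>j. h2 (r r_word + j)) = i"
        and t2: "t2 \<le> t + 4 * L + 5 + i * T"
        using 2 by blast+
      have fr2: "\<forall>j<r_qs. r2 j = r j" using r2 by simp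
      show ?case
        unfolding wp_SEQ
      proof (rule conjI, use r2 in simp, rule wp_try_word[OF S2(2)], goal_cases)
        case 1
        then show ?case using r2 h2 by (simp add: digits_def L_def m_def)
      next
        case 2
        then show ?case using r2 q by simp
      next
        case (3 r3 h3 t3 S3)
        have r3: "\<forall>j<50. j \<noteq> r_top \<longrightarrow> j \<noteq> r_go \<longrightarrow> r3 j = r j" using 3(1) r2 by simp
        have h3: "\<forall>a\<le>r r_prev. h3 a = h2 a" using 3(2) r2 by simp
        have d3: "\<forall>j<L. h3 (r r_word + j) = h2 (r r_word + j)" using h3 lay by simp
        have val3: "word_val m L (\<lambda>j. h3 (r r_word + j)) = i"
          using val word_val_cong[of L "\<lambda>j. h3 (r r_word + j)" "\<lambda>j. h2 (r r_word + j)" m] d3 by simp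
        have t3: "t3 \<le> Suc t2 + try_time r N" using 3(6) r2 by (simp add: try_time_def)
        have hd: "handled r g P S3 ((\<lambda>j. h2 (r r_word + j)) ` {..<r r_q})
            ((\<lambda>j. h2 (r r_word + j)) ` {r r_q..<L})"
          using 3(5) r2 handled_frame[OF fr2] by (simp add: L_def)
        have all3: "handled r g P S3 (d ` {..<r r_q}) (d ` {r r_q..<L})"
          if d: "\<forall>j<L. d j \<in> {1..m}" "word_val m L d < Suc i" for d
        proof (cases "word_val m L d < i")
          case True
          then show ?thesis using S2(3) d handled_mono[OF _ 3(3)] by blast
        next
          case False
          then have "word_val m L d = word_val m L (\<lambda>j. h2 (r r_word + j))" using d val by simp
          then have eq: "d j = h2 (r r_word + j)" if "j < L" for j
            using word_val_inj[of L d m "\<lambda>j. h2 (r r_word + j)" j] d h2(2) that by auto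
          have "d ` {..<r r_q} = (\<lambda>j. h2 (r r_word + j)) ` {..<r r_q}"
            "d ` {r r_q..<L} = (\<lambda>j. h2 (r r_word + j)) ` {r r_q..<L}"
            using q eq by (auto simp: L_def intro!: image_cong)
          then show ?thesis using hd by simp
        qed
        show ?case
        proof (rule wp_advance, goal_cases)
          case (3 j)
          then show ?case using r3 d3 h2 by (simp add: L_def m_def)
        next
          case (4 r4 h4 t4)
          have r4: "\<forall>j<58. r4 j = r3 j" using 4(1) .
          have h4: "\<forall>a. a < r r_word \<or> r r_word + L \<le> a \<longrightarrow> h4 a = h3 a"
            "\<forall>j<L. h4 (r r_word + j) \<in> {1..m}"
            using 4(2,3) r3 by (simp_all add: L_def m_def)
          have wv: "word_val m L (\<lambda>j. h4 (r r_word + j)) + r4 r_carry * m ^ L = Suc i"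
            using 4(5) r3 val3 by (simp add: L_def m_def)
          have lt: "word_val m L (\<lambda>j. h4 (r r_word + j)) < m ^ L"
            using h4(2) by (intro word_val_less) simp
          have c: "r4 r_carry = (if Suc i < m ^ L then 0 else 1)"
          proof (cases "Suc i < m ^ L")
            case True
            then show ?thesis using wv 4(4) by (cases "r4 r_carry") auto
          next
            case False
            then show ?thesis using wv lt 4(4) by (cases "r4 r_carry") auto
          qed
          have go: "(if Suc i < m ^ L then 1 else 0) = 1 - r4 r_carry" by (simp add: c)
          let ?r = "r4(r_go := 1 - r4 r_carry)"
          have inv4: "log_inv g N P (B + Suc i) S3 ?r h4"
            by (rule log_inv_frame[of g N P "B + Suc i" S3 r3 h3])
              (use 3(4) r4 h4 r3 in \<open>auto simp: L_def\<close>)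
          have ex: "\<exists>S'. S \<subseteq> S' \<and> log_inv g N P (B + Suc i) S' ?r h4 \<and>
            (\<forall>d. (\<forall>j<L. d j \<in> {1..m}) \<longrightarrow> word_val m L d < Suc i \<longrightarrow>
            handled r g P S' (d ` {..<r r_q}) (d ` {r r_q..<L}))"
            using inv4 all3 S2(1) 3(3) by blast
          have t4: "t4 \<le> t3 + 10 * L + 4" using 4(6) r3 by (simp add: L_def)
          have ha: "\<forall>a<r r_cnt. h4 a = h a" using h4 h3 h2 lay by auto
          have fr: "\<forall>j<50. j \<noteq> r_top \<longrightarrow> j \<noteq> r_go \<longrightarrow> ?r j = r j" using r3 r4 by simp
          have tt: "Suc t4 \<le> t + 4 * L + 5 + Suc i * T"
            using t4 t3 t2 by (simp add: T_def)
          have wv': "Suc i < m ^ L \<longrightarrow> word_val m L (\<lambda>j. h4 (r r_word + j)) = Suc i"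
            using wv c by auto
          have "r4 r_one = 1" using r4 r3 lay by simp
          then show ?case
            using ex ha fr tt wv' c h4(2) by simp
        qed (use r3 lay in auto)
      qed
    next
      case (3 r2 h2 t2)
      then obtain S2 where S2: "S \<subseteq> S2" "log_inv g N P (B + m ^ L) S2 r2 h2"
        "\<forall>d. (\<forall>j<L. d j \<in> {1..m}) \<longrightarrow> word_val m L d < m ^ L \<longrightarrow>
            handled r g P S2 (d ` {..<r r_q}) (d ` {r r_q..<L})"
        by blast
      have "Q r2 h2 (Suc t2)"
      proof (rule Q[OF _ _ S2(1)])
        show "handled r g P S2 (d ` {..<r r_q}) (d ` {r r_q..<r r_L})"
          if "\<forall>j<r r_L. d j \<in> {1..r r_m}" for d
          using S2(3) that word_val_less[of L d m] by (simp add: L_def m_def)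
      qed (use 3 S2 in \<open>auto simp: L_def m_def T_def words_time_def\<close>)
      then show ?case using 3 by simp
    qed
  qed
qed

definition splits :: ram where
  "splits = ADD r_qs r_L r_one ;;
     WHILENZ r_qs (SUB r_q r_qs r_one ;; words ;; SUB r_qs r_qs r_one)"

lemma wp_splits:
  assumes inv: "log_inv g N P B S r h"
    and Q: "\<And>r' h' t' S'. \<forall>i<r_qs. r' i = r i \<Longrightarrow>
      \<forall>a<r r_cnt. h' a = h a \<Longrightarrow>
      log_inv g N P (B + Suc (r r_L) * r r_m ^ r r_L) S' r' h' \<Longrightarrow>
      (\<And>q d. q \<le> r r_L \<Longrightarrow> \<forall>j<r r_L. d j \<in> {1..r r_m} \<Longrightarrow>
        handled r g P S' (d ` {..<q}) (d ` {q..<r r_L})) \<Longrightarrow>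
      t' \<le> t + Suc (r r_L) * (words_time r N + 3) + 2 \<Longrightarrow> Q r' h' t'"
  shows "wp splits Q r h t"
proof -
  define m where "m = r r_m"
  define L where "L = r r_L"
  from inv obtain M where "layout N M r h" by (auto simp: log_inv_def)
  then have lay: "r r_one = 1" by (auto simp: layout_def)
  show ?thesis
    unfolding splits_def wp_SEQ wp_ADD
  proof (rule wp_while[where N = "Suc L" and Inv = "\<lambda>i r' h' t'.
      (\<forall>j<r_qs. r' j = r j) \<and> r' r_qs = Suc L - i \<and> (\<forall>a<r r_cnt. h' a = h a) \<and>
      (\<exists>S'. log_inv g N P (B + i * m ^ L) S' r' h' \<and>
        (\<forall>q d. Suc L - i \<le> q \<longrightarrow> q \<le> L \<longrightarrow> (\<forall>j<L. d j \<in> {1..m}) \<longrightarrow>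
          handled r g P S' (d ` {..<q}) (d ` {q..<L}))) \<and>
      t' \<le> t + 1 + i * (words_time r N + 3)"], goal_cases)
    case 1
    have "log_inv g N P B S (r(r_qs := r r_L + r r_one)) h"
      by (rule log_inv_frame[OF inv]) auto
    then show ?case using lay by (auto simp: L_def intro!: exI[of _ S])
  next
    case (2 i r1 h1 t1)
    then obtain S1 where S1: "log_inv g N P (B + i * m ^ L) S1 r1 h1"
      "\<forall>q d. Suc L - i \<le> q \<longrightarrow> q \<le> L \<longrightarrow> (\<forall>j<L. d j \<in> {1..m}) \<longrightarrow>
          handled r g P S1 (d ` {..<q}) (d ` {q..<L})" by blast
    have r1: "\<forall>j<r_qs. r1 j = r j" "r1 r_qs = Suc L - i" and h1: "\<forall>a<r r_cnt. h1 a = h a"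
      and t1: "t1 \<le> t + 1 + i * (words_time r N + 3)" and i: "i < Suc L" using 2 by blast+
    let ?r = "r1(r_q := L - i)"
    have inv1: "log_inv g N P (B + i * m ^ L) S1 ?r h1"
      by (rule log_inv_frame[OF S1(1)]) auto
    have "wp words (wp (SUB r_qs r_qs r_one) (\<lambda>r' h' t'. (\<forall>j<r_qs. r' j = r j) \<and>
      r' r_qs = Suc L - Suc i \<and> (\<forall>a<r r_cnt. h' a = h a) \<and>
      (\<exists>S'. log_inv g N P (B + Suc i * m ^ L) S' r' h' \<and>
        (\<forall>q d. Suc L - Suc i \<le> q \<longrightarrow> q \<le> L \<longrightarrow> (\<forall>j<L. d j \<in> {1..m}) \<longrightarrow>
          handled r g P S' (d ` {..<q}) (d ` {q..<L}))) \<and>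
      t' \<le> t + 1 + Suc i * (words_time r N + 3))) ?r h1 (Suc (Suc t1))"
    proof (rule wp_words[OF inv1], goal_cases)
      case 1
      then show ?case using r1 by (simp add: L_def)
    next
      case (2 r2 h2 t2 S2)
      have r2: "\<forall>j<r_qs. r2 j = r j" "r2 r_qs = Suc L - i" using 2(1) r1 by auto
      have frr: "\<forall>j<r_qs. ?r j = r j" using r1 by simp
      have inv2: "log_inv g N P (B + Suc i * m ^ L) S2 (r2(r_qs := L - i)) h2"
        by (rule log_inv_frame[of _ _ _ _ _ r2 h2])
          (use 2(4) r1 in \<open>auto simp: L_def m_def add.commute add.left_commute\<close>)
      have all2: "handled r g P S2 (d ` {..<q}) (d ` {q..<L})"
        if "L - i \<le> q" "q \<le> L" "\<forall>j<L. d j \<in> {1..m}" for q d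
      proof (cases "q = L - i")
        case True
        then show ?thesis using 2(5)[of d, unfolded handled_frame[OF frr]] that r1
          by (simp add: L_def m_def)
      next
        case False
        then have "Suc L - i \<le> q" using that i by simp
        then show ?thesis using S1(2) that handled_mono[OF _ 2(3)] by blast
      qed
      have t2: "t2 \<le> Suc (Suc t1) + words_time r N"
        using 2(6) r1 by (simp add: words_time_def try_time_def)
      have ha: "\<forall>a<r r_cnt. h2 a = h a" using 2(2) r1 h1 by simp
      have "r2 r_one = 1" using r2 lay by simp
      then show ?case using r2 ha inv2 all2 t2 t1 i by auto
    qed
    then show ?case using r1 lay i by simp
  next
    case (3 r1 h1 t1)
    then obtain S1 where S1: "log_inv g N P (B + Suc L * m ^ L) S1 r1 h1"
      "\<forall>q d. Suc L - Suc L \<le> q \<longrightarrow> q \<le> L \<longrightarrow> (\<forall>j<L. d j \<in> {1..m}) \<longrightarrow>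
          handled r g P S1 (d ` {..<q}) (d ` {q..<L})" by blast
    have "Q r1 h1 (Suc t1)"
      by (rule Q[of _ _ S1]) (use 3 S1 in \<open>auto simp: L_def m_def\<close>)
    then show ?case using 3 by simp
  qed
qed

definition stage :: ram where
  "stage = ADD r_ptr r_cnt r_zero ;; ADD r_ctr r_m r_one ;; SETC r_val 0 ;; fill ;;
     count_votes ;; ADD r_prev r_cur r_zero ;; ADD r_cur r_top r_zero ;; splits ;;
     SETC r_first 0 ;; SUB r_stages r_stages r_one"

definition stage_time :: "(nat \<Rightarrow> nat) \<Rightarrow> nat \<Rightarrow> nat" where
  "stage_time r N = Suc (r r_L) * (words_time r N + 3) + 4 * r r_m + 8 * r r_n + 16"

lemma wp_stage:
  assumes lay: "layout N M r h"
    and votes: "\<And>i. i < r r_n \<Longrightarrow> h (r r_votes + i) \<le> r r_m"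
    and le: "r r_votes + r r_n \<le> r r_cnt"
    and g: "g = (\<lambda>j. card {i. i < r r_n \<and> h (r r_votes + i) = j})"
    and P: "P = recs h (r r_cur) M (r r_m)"
    and Q: "\<And>r' h' t' M' S. \<forall>i<r_votes. i \<noteq> r_stages \<longrightarrow> r' i = r i \<Longrightarrow>
      r' r_stages = r r_stages - 1 \<Longrightarrow> r' r_votes = r r_votes + r r_n \<Longrightarrow> r' r_first = 0 \<Longrightarrow>
      \<forall>a<r r_cnt. h' a = h a \<Longrightarrow> layout M M' r' h' \<Longrightarrow> M' \<le> Suc (r r_L) * r r_m ^ r r_L \<Longrightarrow>
      recs h' (r' r_cur) M' (r r_m) = S \<Longrightarrow> (\<And>G. G \<in> S \<Longrightarrow> accept r g P G) \<Longrightarrow>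
      (\<And>q d. q \<le> r r_L \<Longrightarrow> \<forall>j<r r_L. d j \<in> {1..r r_m} \<Longrightarrow>
        handled r g P S (d ` {..<q}) (d ` {q..<r r_L})) \<Longrightarrow>
      t' \<le> t + stage_time r M \<Longrightarrow> Q r' h' t'"
  shows "wp stage Q r h t"
proof -
  have l: "r r_one = 1" "r r_two = 2" "r r_zero = 0" "0 < r r_m"
     "r r_cnt + r r_m < r r_word" "r r_word + r r_L \<le> r r_prev"
     "r r_cur = r r_prev + N * r r_m" "r r_top = r r_cur + M * r r_m"
     "\<forall>c. r r_prev < c \<and> c \<le> r r_top \<longrightarrow> h c \<le> 1"
    using lay unfolding layout_def by blast+
  show ?thesis
    unfolding stage_def wp_SEQ wp_ADD wp_SETC
  proof (rule wp_fill, goal_cases)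
    case 1
    then show ?case using l by simp
  next
    case (2 r1 h1 t1)
    have r1: "\<forall>i<60. r1 i = r i" using 2(1) by simp
    have h1: "\<forall>a. a < r r_cnt \<or> r r_cnt + r r_m < a \<longrightarrow> h1 a = h a" "\<forall>j\<le>r r_m. h1 (r r_cnt + j) = 0"
      using 2(2) l by auto
    have t1: "t1 \<le> t + 4 * r r_m + 8" using 2(3) l by simp
    have v1: "\<forall>i<r r_n. h1 (r r_votes + i) = h (r r_votes + i)" using h1(1) le by auto
    show ?case
    proof (rule wp_count_votes, goal_cases)
      case (5 r2 h2 t2)
      have r2: "\<forall>i<60. i \<noteq> r_votes \<longrightarrow> r2 i = r i" "r2 r_votes = r r_votes + r r_n"
        using 5(1,2) r1 by auto
      have h2: "\<forall>a. a < r r_cnt \<or> r r_cnt + r r_m < a \<longrightarrow> h2 a = h a" using 5(3) r1 h1 by simp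
      have c2: "\<forall>j\<le>r r_m. h2 (r r_cnt + j) = g j"
      proof (intro allI impI)
        fix j assume "j \<le> r r_m"
        then have "h2 (r r_cnt + j) = card {i. i < r r_n \<and> h1 (r r_votes + i) = j}"
          using 5(4) r1 h1(2) by simp
        also have "{i. i < r r_n \<and> h1 (r r_votes + i) = j} = {i. i < r r_n \<and> h (r r_votes + i) = j}"
          using v1 by auto
        finally show "h2 (r r_cnt + j) = g j" by (simp add: g)
      qed
      have gn: "g j \<le> r r_n" for j
      proof -
        have "card {i. i < r r_n \<and> h (r r_votes + i) = j} \<le> card {..<r r_n}"
          by (rule card_mono) auto
        then show ?thesis by (simp add: g)
      qed
      have t2: "t2 \<le> t + 4 * r r_m + 8 * r r_n + 10" using 5(5) t1 r1 by simp
      define r3 where "r3 = r2(r_prev := r r_cur, r_cur := r r_top)"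
      have r3: "r2(r_prev := r2 r_cur + r2 r_zero, r_cur := (r2(r_prev := r2 r_cur + r2 r_zero)) r_top + (r2(r_prev := r2 r_cur + r2 r_zero)) r_zero) = r3"
        using r2 l by (simp add: r3_def)
      have f3: "\<forall>i<60. i \<noteq> r_votes \<longrightarrow> i \<noteq> r_prev \<longrightarrow> i \<noteq> r_cur \<longrightarrow> r3 i = r i"
        "r3 r_votes = r r_votes + r r_n" "r3 r_prev = r r_cur" "r3 r_cur = r r_top"
        using r2 by (auto simp: r3_def)
      have hh: "h2 c = h c" if "r r_cur < c" for c
        using that l h2 by simp
      have "recs h2 (r r_cur) M (r r_m) = P"
        unfolding P by (rule recs_cong) (simp add: hh)
      moreover have "counts g r3 h2" using c2 gn f3 by (simp add: counts_def)
      moreover have "layout M 0 r3 h2" using l f3 hh by (auto simp: layout_def)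
      ultimately have inv: "log_inv g M P 0 {} r3 h2"
        using f3 by (auto simp: log_inv_def)
      show ?case
        unfolding wp_ADD wp_SEQ r3
      proof (rule wp_splits[OF inv], goal_cases)
        case (1 r4 h4 t4 S4)
        then obtain M' where M': "M' \<le> Suc (r r_L) * r r_m ^ r r_L" "layout M M' r4 h4"
          "recs h4 (r4 r_cur) M' (r4 r_m) = S4" "\<forall>G\<in>S4. accept r4 g P G"
          using f3 by (auto simp: log_inv_def)
        have r4: "\<forall>i<r_votes. r4 i = r i" "r4 r_first = r r_first" "r4 r_votes = r r_votes + r r_n"
          using 1(1) f3 by auto
        have acc: "accept r4 g P G = accept r g P G" "accept r3 g P G = accept r g P G" for G
          using r4 f3 by (simp_all add: accept_def)
        have han: "handled r3 g P S4 X Y = handled r g P S4 X Y" for X Y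
          using f3 by (simp add: handled_def acc)
        have wt: "words_time r3 M = words_time r M"
          using f3 by (simp add: words_time_def try_time_def)
        have "Q (r4(r_first := 0, r_stages := r r_stages - 1)) h4 (Suc (Suc t4))"
        proof (rule Q[of _ _ M' S4])
          show "layout M M' (r4(r_first := 0, r_stages := r r_stages - 1)) h4"
            using M'(2) by (simp add: layout_def)
          show "accept r g P G" if "G \<in> S4" for G using M'(4) acc that by simp
          show "handled r g P S4 (d ` {..<q}) (d ` {q..<r r_L})"
            if "q \<le> r r_L" "\<forall>j<r r_L. d j \<in> {1..r r_m}" for q d
            using 1(4)[of q d] that f3 han by simp
          show "Suc (Suc t4) \<le> t + stage_time r M"
            using 1(5) t2 f3 wt by (simp add: stage_time_def)
          show "\<forall>a<r r_cnt. h4 a = h a" using 1(2) f3 h2 by simp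
        qed (use r4 M' in auto)
        then show ?case using r4 l by simp
      qed
    qed (use r1 l v1 votes le in auto)
  qed
qed

section \<open>Representative committees\<close>

definition committees ::
  "(nat \<Rightarrow> nat \<Rightarrow> nat) \<Rightarrow> nat \<Rightarrow> nat \<Rightarrow> nat \<Rightarrow> nat \<Rightarrow> nat \<Rightarrow> nat set list \<Rightarrow> bool" where
  "committees g m k x l T Cs \<longleftrightarrow> length Cs = T \<and>
     (\<forall>t<T. Cs ! t \<subseteq> {1..m} \<and> card (Cs ! t) \<le> k \<and> x \<le> sum (g t) (Cs ! t)) \<and>
     (\<forall>t. Suc t < T \<longrightarrow> l \<le> card (sym_diff (Cs ! t) (Cs ! Suc t)))"

lemma committees_snoc:
  "committees g m k x l (Suc T) (Cs @ [C]) \<longleftrightarrow> committees g m k x l T Cs \<and>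
     C \<subseteq> {1..m} \<and> card C \<le> k \<and> x \<le> sum (g T) C \<and>
     (T > 0 \<longrightarrow> l \<le> card (sym_diff (last Cs) C))" (is "?l \<longleftrightarrow> ?r")
proof (cases "length Cs = T")
  case True
  have "(\<forall>t. Suc t < Suc T \<longrightarrow> l \<le> card (sym_diff ((Cs @ [C]) ! t) ((Cs @ [C]) ! Suc t))) \<longleftrightarrow>
    (\<forall>t. Suc t < T \<longrightarrow> l \<le> card (sym_diff (Cs ! t) (Cs ! Suc t))) \<and>
     (T > 0 \<longrightarrow> l \<le> card (sym_diff (last Cs) C))"
    (is "(\<forall>t. ?A t) \<longleftrightarrow> (\<forall>t. ?B t) \<and> ?C")
  proof -
    have "?A t \<longleftrightarrow> ?B t" if "Suc t \<noteq> T" for t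
      using that True by (auto simp: nth_append)
    moreover have "?A t \<longleftrightarrow> ?C" if "Suc t = T" for t
      using that True last_conv_nth[of Cs] by (force simp: nth_append)
    moreover have "?B t" if "Suc t = T" for t using that by simp
    moreover have "?C" if "T = 0" using that by simp
    ultimately show ?thesis by (metis gr0_implies_Suc neq0_conv)
  qed
  then show ?thesis using True
    by (auto simp: committees_def nth_append less_Suc_eq simp del: Suc_less_eq)
next
  case False
  then show ?thesis by (auto simp: committees_def)
qed

lemma ex_surj_lessThan:
  assumes "finite X" "card X \<le> a" "X = {} \<longrightarrow> a = 0"
  shows "\<exists>f :: nat \<Rightarrow> 'b. f ` {..<a} = X"
proof (cases "X = {}")
  case False
  obtain f where f: "f ` {..<card X} = X"
    using ex_bij_betw_nat_finite[OF assms(1)] by (auto simp: bij_betw_def lessThan_atLeast0)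
  have pos: "0 < card X" using assms(1) False by (simp add: card_gt_0_iff)
  have "(\<lambda>j. if j < card X then f j else f 0) ` {..<a} = X"
  proof
    show "(\<lambda>j. if j < card X then f j else f 0) ` {..<a} \<subseteq> X" using f pos by auto
    show "X \<subseteq> (\<lambda>j. if j < card X then f j else f 0) ` {..<a}"
    proof
      fix y assume "y \<in> X"
      then obtain i where "i < card X" "y = f i" using f by auto
      then show "y \<in> (\<lambda>j. if j < card X then f j else f 0) ` {..<a}"
        using assms(2) by (intro image_eqI[of _ _ i]) simp_all
    qed
  qed
  then show ?thesis by blast
qed (use assms(3) in simp)

lemma ex_word:
  fixes X Y :: "nat set"
  assumes "X \<subseteq> {1..m}" "Y \<subseteq> {1..m}" "card X + card Y \<le> L"
    and ne: "X \<union> Y = {} \<longrightarrow> L = 0"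
  shows "\<exists>q d. q \<le> L \<and> (\<forall>j<L. d j \<in> {1..m}) \<and> d ` {..<q} = X \<and> d ` {q..<L} = Y"
proof -
  have fin: "finite X" "finite Y"
    using assms(1,2) finite_subset by blast+
  define q where "q = (if Y = {} then L else card X)"
  have q: "q \<le> L" "card X \<le> q" "card Y \<le> L - q" "X = {} \<longrightarrow> q = 0" "Y = {} \<longrightarrow> L - q = 0"
    using assms by (auto simp: q_def)
  obtain f where f: "f ` {..<q} = X" using ex_surj_lessThan[OF fin(1) q(2,4)] by blast
  obtain f' where f': "f' ` {..<L - q} = Y" using ex_surj_lessThan[OF fin(2) q(3,5)] by blast
  define d where "d = (\<lambda>j. if j < q then f j else f' (j - q))"
  have 1: "d ` {..<q} = X" using f by (simp add: d_def)
  have "d ` {q..<L} = f' ` ((\<lambda>j. j - q) ` {q..<L})" by (auto simp: d_def image_image)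
  also have "(\<lambda>j. j - q) ` {q..<L} = {..<L - q}"
  proof
    show "{..<L - q} \<subseteq> (\<lambda>j. j - q) ` {q..<L}"
    proof
      fix i assume "i \<in> {..<L - q}"
      then show "i \<in> (\<lambda>j. j - q) ` {q..<L}" by (intro image_eqI[of _ _ "i + q"]) auto
    qed
  qed auto
  finally have 2: "d ` {q..<L} = Y" using f' by simp
  have "d j \<in> {1..m}" if "j < L" for j
  proof -
    have "d j \<in> X \<union> Y" using that 1 2 by (cases "j < q") auto
    then show ?thesis using assms by auto
  qed
  with 1 2 q(1) show ?thesis by blast
qed

lemma ex_witness_set:
  assumes "finite A" "finite B" "l \<le> card (sym_diff A B)"
  shows "\<exists>D. D \<subseteq> A \<union> B \<and> card D = l \<and>
    (\<forall>B'. finite B' \<longrightarrow> B' \<inter> D = B \<inter> D \<longrightarrow> l \<le> card (sym_diff A B'))"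
proof -
  obtain D where D: "D \<subseteq> sym_diff A B" "card D = l"
    using obtain_subset_with_card_n[OF assms(3)] by blast
  have "l \<le> card (sym_diff A B')" if "finite B'" "B' \<inter> D = B \<inter> D" for B'
  proof -
    have "D \<subseteq> sym_diff A B'" using D(1) that(2) by blast
    then show ?thesis using D(2) that(1) assms(1) card_mono[of "sym_diff A B'" D] by simp
  qed
  with D show ?thesis by (intro exI[of _ D]) auto
qed

lemma stage_complete:
  assumes L: "r r_L = 2 * r r_l" and m: "0 < r r_m"
    and P: "\<And>p. p \<in> P \<Longrightarrow> p \<subseteq> {1..r r_m}"
    and handled: "\<And>q d. q \<le> r r_L \<Longrightarrow> \<forall>j<r r_L. d j \<in> {1..r r_m} \<Longrightarrow>
        handled r g P S (d ` {..<q}) (d ` {q..<r r_L})"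
    and C: "accept r g P C" and C': "C' \<subseteq> {1..r r_m}"
  shows "\<exists>G\<in>S. r r_l \<le> card (sym_diff C C') \<longrightarrow> r r_l \<le> card (sym_diff G C')"
proof -
  define m where "m = r r_m"
  define l where "l = r r_l"
  have Cm: "C \<subseteq> {1..m}" "card C \<le> r r_k" "r r_x \<le> sum g C"
    using C by (auto simp: accept_def m_def)
  have fin: "finite C" "finite C'" using Cm C' finite_subset by blast+
  obtain D1 where D1: "D1 \<subseteq> {1..m}" "card D1 \<le> l"
    "\<forall>G. finite G \<longrightarrow> G \<inter> D1 = C \<inter> D1 \<longrightarrow>
       r r_first \<noteq> 0 \<or> (\<exists>p\<in>P. l \<le> card (sym_diff p G))"
  proof (cases "r r_first = 0")
    case False
    then show thesis using that[of "{}"] by simp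
  next
    case True
    then obtain p where p: "p \<in> P" "l \<le> card (sym_diff p C)" using C by (auto simp: accept_def l_def)
    then have "finite p" "p \<subseteq> {1..m}" using P[of p] finite_subset by (auto simp: m_def)
    with ex_witness_set[OF _ fin(1) p(2)] obtain D where D: "D \<subseteq> p \<union> C" "card D = l"
      "\<forall>B'. finite B' \<longrightarrow> B' \<inter> D = C \<inter> D \<longrightarrow> l \<le> card (sym_diff p B')" by blast
    have "D \<subseteq> {1..m}" using D(1) \<open>p \<subseteq> {1..m}\<close> Cm(1) by blast
    with D p show thesis by (intro that[of D]) auto
  qed
  obtain D2 where D2: "D2 \<subseteq> {1..m}" "card D2 \<le> l"
    "\<forall>G. finite G \<longrightarrow> G \<inter> D2 = C \<inter> D2 \<longrightarrow> l \<le> card (sym_diff C C') \<longrightarrow> l \<le> card (sym_diff G C')"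
  proof (cases "l \<le> card (sym_diff C C')")
    case False
    then show thesis using that[of "{}"] by simp
  next
    case True
    then have "l \<le> card (sym_diff C' C)" by (simp add: Un_commute)
    from ex_witness_set[OF fin(2,1) this] obtain D where D: "D \<subseteq> C' \<union> C" "card D = l"
      "\<forall>B'. finite B' \<longrightarrow> B' \<inter> D = C \<inter> D \<longrightarrow> l \<le> card (sym_diff C' B')" by blast
    have "D \<subseteq> {1..m}" using D(1) C' Cm(1) unfolding m_def by blast
    with D show thesis by (intro that[of D]) (auto simp: Un_commute)
  qed
  define D where "D = (if D1 \<union> D2 = {} \<and> l > 0 then {1} else D1 \<union> D2)"
  have D: "D1 \<subseteq> D" "D2 \<subseteq> D" "D \<subseteq> {1..m}" using D1(1) D2(1) m by (auto simp: D_def m_def)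
  have finD: "finite D" using D(3) finite_subset by blast
  have cD: "card D \<le> 2 * l" using D1(2) D2(2) card_Un_le[of D1 D2] by (auto simp: D_def)
  have "card (C \<inter> D) + card (D - C) = card D"
    using finD by (metis Int_commute card_Int_Diff)
  moreover have "(C \<inter> D) \<union> (D - C) = {} \<longrightarrow> 2 * l = 0"
    by (auto simp: D_def)
  ultimately have "\<exists>q d. q \<le> 2 * l \<and> (\<forall>j<2 * l. d j \<in> {1..m}) \<and>
      d ` {..<q} = C \<inter> D \<and> d ` {q..<2 * l} = D - C"
    using cD D(3) Cm(1) by (intro ex_word) auto
  then obtain q d where qd: "q \<le> 2 * l" "\<forall>j<2 * l. d j \<in> {1..m}"
    "d ` {..<q} = C \<inter> D" "d ` {q..<2 * l} = D - C"
    by blast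
  then have "handled r g P S (C \<inter> D) (D - C)"
    using handled[of q d] L by (simp add: l_def m_def)
  then obtain G where G: "covers m g (r r_k) (C \<inter> D) (D - C) G" "accept r g P G \<longrightarrow> G \<in> S"
    by (auto simp: handled_def m_def)
  have "card (C \<inter> D) \<le> r r_k" using Cm(2) fin(1) by (meson Int_lower1 card_mono le_trans)
  with G(1) have cov: "G \<subseteq> {1..m}" "C \<inter> D \<subseteq> G" "G \<inter> (D - C) = {}" "card G \<le> r r_k"
    "\<forall>S\<subseteq>{1..m}. C \<inter> D \<subseteq> S \<longrightarrow> S \<inter> (D - C) = {} \<longrightarrow> card S \<le> r r_k \<longrightarrow> sum g S \<le> sum g G"
    unfolding covers_def by blast+
  have finG: "finite G" using cov(1) finite_subset by blast
  have GD: "G \<inter> D1 = C \<inter> D1" "G \<inter> D2 = C \<inter> D2" using cov(2,3) D by blast+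
  have "sum g C \<le> sum g G" using cov(5) Cm by blast
  then have "r r_x \<le> sum g G" using Cm(3) by simp
  moreover have "r r_first \<noteq> 0 \<or> (\<exists>p\<in>P. r r_l \<le> card (sym_diff p G))"
    using D1(3) finG GD(1) unfolding l_def by blast
  ultimately have "accept r g P G"
    using cov(1,4) unfolding accept_def m_def by blast
  then have "G \<in> S" using G(2) by blast
  moreover have "r r_l \<le> card (sym_diff C C') \<longrightarrow> r r_l \<le> card (sym_diff G C')"
    using D2(3) finG GD(2) unfolding l_def by blast
  ultimately show ?thesis by blast
qed

definition represents ::
  "(nat \<Rightarrow> nat \<Rightarrow> nat) \<Rightarrow> nat \<Rightarrow> nat \<Rightarrow> nat \<Rightarrow> nat \<Rightarrow> nat \<Rightarrow> nat set set \<Rightarrow> bool" where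
  "represents g m k x l T S \<longleftrightarrow> (T > 0 \<longrightarrow>
     (\<forall>G\<in>S. G \<subseteq> {1..m} \<and> (\<exists>Cs. committees g m k x l T Cs \<and> last Cs = G)) \<and>
     (\<forall>Cs C'. committees g m k x l T Cs \<longrightarrow> C' \<subseteq> {1..m} \<longrightarrow>
       (\<exists>G\<in>S. l \<le> card (sym_diff (last Cs) C') \<longrightarrow> l \<le> card (sym_diff G C'))))"

lemma represents_nonempty:
  assumes "represents g m k x l T S" "T > 0"
  shows "S \<noteq> {} \<longleftrightarrow> (\<exists>Cs. committees g m k x l T Cs)"
  using assms unfolding represents_def by (metis all_not_in_conv empty_subsetI)

lemma represents_Suc:
  assumes L: "r r_L = 2 * r r_l" and m: "0 < r r_m"
    and first: "r r_first \<noteq> 0 \<longleftrightarrow> T = 0"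
    and P0: "\<And>p. p \<in> P \<Longrightarrow> p \<subseteq> {1..r r_m}"
    and P: "represents g (r r_m) (r r_k) (r r_x) (r r_l) T P"
    and acc: "\<And>G. G \<in> S \<Longrightarrow> accept r (g T) P G"
    and handled: "\<And>q d. q \<le> r r_L \<Longrightarrow> \<forall>j<r r_L. d j \<in> {1..r r_m} \<Longrightarrow>
        handled r (g T) P S (d ` {..<q}) (d ` {q..<r r_L})"
  shows "represents g (r r_m) (r r_k) (r r_x) (r r_l) (Suc T) S"
  unfolding represents_def
proof (intro impI conjI ballI allI)
  fix G assume "G \<in> S"
  note a = acc[OF this, unfolded accept_def]
  then show "G \<subseteq> {1..r r_m}" by blast
  show "\<exists>Cs. committees g (r r_m) (r r_k) (r r_x) (r r_l) (Suc T) Cs \<and> last Cs = G"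
  proof (cases "T = 0")
    case True
    then have "committees g (r r_m) (r r_k) (r r_x) (r r_l) (Suc T) ([] @ [G])"
      unfolding committees_snoc using a by (simp add: committees_def)
    then show ?thesis by force
  next
    case False
    then obtain p where p: "p \<in> P" "r r_l \<le> card (sym_diff p G)" using a first by auto
    then obtain Cs where "committees g (r r_m) (r r_k) (r r_x) (r r_l) T Cs" "last Cs = p"
      using P False by (auto simp: represents_def)
    then have "committees g (r r_m) (r r_k) (r r_x) (r r_l) (Suc T) (Cs @ [G])"
      unfolding committees_snoc using a p by simp
    then show ?thesis by force
  qed
next
  fix Cs C' assume Cs: "committees g (r r_m) (r r_k) (r r_x) (r r_l) (Suc T) Cs"
    and C': "C' \<subseteq> {1..r r_m}"
  then have "Cs \<noteq> []" by (auto simp: committees_def)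
  then obtain Bs C where BC: "Cs = Bs @ [C]" by (metis append_butlast_last_id)
  note c = Cs[unfolded BC committees_snoc]
  have "accept r (g T) P C"
  proof (cases "T = 0")
    case True
    then show ?thesis using c first by (simp add: accept_def)
  next
    case False
    then have "\<forall>Cs C'. committees g (r r_m) (r r_k) (r r_x) (r r_l) T Cs \<longrightarrow> C' \<subseteq> {1..r r_m} \<longrightarrow>
       (\<exists>G\<in>P. r r_l \<le> card (sym_diff (last Cs) C') \<longrightarrow> r r_l \<le> card (sym_diff G C'))"
      using P by (simp add: represents_def)
    from this[rule_format, of Bs C] obtain G where "G \<in> P" "r r_l \<le> card (sym_diff G C)"
      using c False by blast
    then show ?thesis using c unfolding accept_def by blast
  qed
  from stage_complete[OF L m P0 handled this C']
  show "\<exists>G\<in>S. r r_l \<le> card (sym_diff (last Cs) C') \<longrightarrow> r r_l \<le> card (sym_diff G C')"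
    by (simp add: BC)
qed

section \<open>The complete program\<close>

definition prepare :: ram where
  "prepare = ADD r_L r_l r_l ;; ADD r_votes r_ptr r_zero ;; ADD r_cnt r_ptr r_zero ;;
     ADD r_ctr r_stages r_zero ;; WHILENZ r_ctr (ADD r_cnt r_cnt r_n ;; SUB r_ctr r_ctr r_one) ;;
     ADD r_word r_cnt r_m ;; ADD r_word r_word r_one ;; ADD r_prev r_word r_L ;;
     ADD r_cur r_prev r_zero ;; ADD r_top r_prev r_zero ;; SETC r_first 1"

lemma wp_prepare:
  assumes regs: "r r_one = 1" "r r_zero = 0"
    and Q: "\<And>r' t'. \<forall>i<r_L. r' i = r i \<Longrightarrow> r' r_zero = 0 \<Longrightarrow> r' r_L = 2 * r r_l \<Longrightarrow>
      r' r_votes = r r_ptr \<Longrightarrow> r' r_cnt = r r_ptr + r r_stages * r r_n \<Longrightarrow>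
      r' r_word = Suc (r' r_cnt + r r_m) \<Longrightarrow> r' r_prev = r' r_word + r' r_L \<Longrightarrow>
      r' r_cur = r' r_prev \<Longrightarrow> r' r_top = r' r_prev \<Longrightarrow> r' r_first = 1 \<Longrightarrow>
      t' \<le> t + 3 * r r_stages + 11 \<Longrightarrow> Q r' h t'"
  shows "wp prepare Q r h t"
  unfolding prepare_def wp_SEQ wp_ADD
proof (rule wp_while[where N = "r r_stages" and Inv = "\<lambda>i r' h' t'.
    (\<forall>j<r_L. r' j = r j) \<and> r' r_zero = 0 \<and> r' r_L = 2 * r r_l \<and> r' r_votes = r r_ptr \<and>
    r' r_ctr = r r_stages - i \<and> r' r_cnt = r r_ptr + i * r r_n \<and> h' = h \<and>
    t' \<le> t + 3 * i + 4"], goal_cases)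
  case 1
  then show ?case using regs by simp
next
  case (2 i r' h' t')
  then show ?case using regs by simp
next
  case (3 r' h' t')
  then show ?case using regs by (auto intro!: Q)
qed

lemma words_time_mono: "N \<le> N' \<Longrightarrow> words_time r N \<le> words_time r N'"
  by (simp add: words_time_def try_time_def)

lemma stage_time_mono: "N \<le> N' \<Longrightarrow> stage_time r N \<le> stage_time r N'"
  using words_time_mono[of N N' r] by (simp add: stage_time_def add_mono mult_le_mono)

lemma stage_time_cong:
  assumes "r' r_n = r r_n" "r' r_m = r r_m" "r' r_L = r r_L"
  shows "stage_time r' N = stage_time r N"
  using assms by (simp add: stage_time_def words_time_def try_time_def)

lemma wp_stages:
  assumes lay: "layout 0 0 r h" and L: "r r_L = 2 * r r_l" and first: "r r_first = 1"
    and cnt: "r r_cnt = r r_votes + r r_stages * r r_n"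
    and votes: "\<And>a. a < r r_cnt \<Longrightarrow> r r_votes \<le> a \<Longrightarrow> h a \<le> r r_m"
    and g: "g = (\<lambda>t j. card {i. i < r r_n \<and> h (r r_votes + t * r r_n + i) = j})"
    and Q: "\<And>r' h' t'. (r' r_top - r' r_cur + r' r_first \<noteq> 0 \<longleftrightarrow>
        (\<exists>Cs. committees g (r r_m) (r r_k) (r r_x) (r r_l) (r r_stages) Cs)) \<Longrightarrow>
      t' \<le> t + r r_stages * (stage_time r (Suc (r r_L) * r r_m ^ r r_L) + 1) + 1 \<Longrightarrow> Q r' h' t'"
  shows "wp (WHILENZ r_stages stage) Q r h t"
proof -
  define W where "W = Suc (r r_L) * r r_m ^ r r_L"
  define T where "T = r r_stages"
  have m: "0 < r r_m" and one: "r r_one = 1" using lay by (auto simp: layout_def)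
  show ?thesis
  proof (rule wp_while[where N = T and Inv = "\<lambda>i r' h' t'.
      (\<forall>j<r_votes. j \<noteq> r_stages \<longrightarrow> r' j = r j) \<and> r' r_stages = T - i \<and>
      r' r_votes = r r_votes + i * r r_n \<and> r' r_first = (if i = 0 then 1 else 0) \<and>
      (\<forall>a<r r_cnt. h' a = h a) \<and>
      (\<exists>N M. layout N M r' h' \<and> M \<le> W \<and>
        represents g (r r_m) (r r_k) (r r_x) (r r_l) i (recs h' (r' r_cur) M (r r_m))) \<and>
      t' \<le> t + i * (stage_time r W + 1)"], goal_cases)
    case 1
    then show ?case using lay first by (auto simp: T_def represents_def intro!: exI[of _ 0])
  next
    case (2 i r1 h1 t1)
    then obtain N M where NM: "layout N M r1 h1" "M \<le> W"
      "represents g (r r_m) (r r_k) (r r_x) (r r_l) i (recs h1 (r1 r_cur) M (r r_m))" by blast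
    have r1: "\<forall>j<r_votes. j \<noteq> r_stages \<longrightarrow> r1 j = r j" "r1 r_stages = T - i"
      "r1 r_votes = r r_votes + i * r r_n" "r1 r_first = (if i = 0 then 1 else 0)"
      and h1: "\<forall>a<r r_cnt. h1 a = h a" and t1: "t1 \<le> t + i * (stage_time r W + 1)"
      and i: "i < T"
      using 2 by blast+
    have bnd: "i * r r_n + r r_n \<le> T * r r_n"
      using record_bound[OF i, of "r r_n" "r r_n"] by simp
    have votes1: "h1 (r1 r_votes + j) = h (r r_votes + i * r r_n + j)" "r r_votes + i * r r_n + j < r r_cnt"
      if "j < r r_n" for j
      using that h1 r1(3) bnd cnt by (auto simp: T_def)
    have gi: "g i = (\<lambda>j. card {i'. i' < r1 r_n \<and> h1 (r1 r_votes + i') = j})"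
    proof
      fix j
      have "{i'. i' < r1 r_n \<and> h1 (r1 r_votes + i') = j} =
         {i'. i' < r r_n \<and> h (r r_votes + i * r r_n + i') = j}"
        using votes1(1) r1(1) by auto
      then show "g i j = card {i'. i' < r1 r_n \<and> h1 (r1 r_votes + i') = j}" by (simp add: g)
    qed
    have "wp stage (\<lambda>r' h' t'.
      (\<forall>j<r_votes. j \<noteq> r_stages \<longrightarrow> r' j = r j) \<and> r' r_stages = T - Suc i \<and>
      r' r_votes = r r_votes + Suc i * r r_n \<and> r' r_first = (if Suc i = 0 then 1 else 0) \<and>
      (\<forall>a<r r_cnt. h' a = h a) \<and>
      (\<exists>N M. layout N M r' h' \<and> M \<le> W \<and>
        represents g (r r_m) (r r_k) (r r_x) (r r_l) (Suc i) (recs h' (r' r_cur) M (r r_m))) \<and>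
      t' \<le> t + Suc i * (stage_time r W + 1)) r1 h1 (Suc t1)"
    proof (rule wp_stage[OF NM(1) _ _ gi refl], goal_cases)
      case (1 j)
      then have "j < r r_n" using r1 by simp
      then show ?case using votes1 votes[of "r r_votes + i * r r_n + j"] r1 by simp
    next
      case 2
      then show ?case using r1 cnt bnd by (simp add: T_def)
    next
      case (3 r2 h2 t2 M' S)
      have st: "stage_time r1 M \<le> stage_time r W"
        using stage_time_mono[OF NM(2), of r] stage_time_cong[of r1 r M] r1 by simp
      have "represents g (r1 r_m) (r1 r_k) (r1 r_x) (r1 r_l) (Suc i) S"
      proof (rule represents_Suc[where P = "recs h1 (r1 r_cur) M (r1 r_m)"])
        show "represents g (r1 r_m) (r1 r_k) (r1 r_x) (r1 r_l) i (recs h1 (r1 r_cur) M (r1 r_m))"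
          using NM(3) r1 by simp
        show "p \<subseteq> {1..r1 r_m}" if "p \<in> recs h1 (r1 r_cur) M (r1 r_m)" for p
          using that by (auto simp: recs_def comm_def)
        show "accept r1 (g i) (recs h1 (r1 r_cur) M (r1 r_m)) G" if "G \<in> S" for G
          using 3(9) that .
        show "handled r1 (g i) (recs h1 (r1 r_cur) M (r1 r_m)) S (d ` {..<q}) (d ` {q..<r1 r_L})"
          if "q \<le> r1 r_L" "\<forall>j<r1 r_L. d j \<in> {1..r1 r_m}" for q d
          using 3(10) that .
      qed (use r1 L m in auto)
      then have rep: "represents g (r r_m) (r r_k) (r r_x) (r r_l) (Suc i)
          (recs h2 (r2 r_cur) M' (r r_m))"
        using 3(8) r1 by simp
      have ex: "\<exists>N M. layout N M r2 h2 \<and> M \<le> W \<and>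
        represents g (r r_m) (r r_k) (r r_x) (r r_l) (Suc i) (recs h2 (r2 r_cur) M (r r_m))"
        using 3(6,7) rep r1 unfolding W_def by (intro exI[of _ M] exI[of _ M']) simp
      have "t2 \<le> t + Suc i * (stage_time r W + 1)"
        using 3(11) st t1 by simp
      then show ?case using 3(1-5) r1 h1 ex by simp
    qed
    then show ?case using r1 i by simp
  next
    case (3 r1 h1 t1)
    then obtain N M where NM: "layout N M r1 h1"
      "represents g (r r_m) (r r_k) (r r_x) (r r_l) T (recs h1 (r1 r_cur) M (r r_m))" by blast
    have f: "r1 r_first = (if T = 0 then 1 else 0)" using 3 by blast
    have mm: "r1 r_m = r r_m" using 3 by simp
    have "r1 r_top - r1 r_cur = M * r r_m" using NM(1) mm by (simp add: layout_def)
    then have "r1 r_top - r1 r_cur \<noteq> 0 \<longleftrightarrow> recs h1 (r1 r_cur) M (r r_m) \<noteq> {}"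
      using m by (auto simp: recs_def)
    then have "r1 r_top - r1 r_cur + r1 r_first \<noteq> 0 \<longleftrightarrow>
        (\<exists>Cs. committees g (r r_m) (r r_k) (r r_x) (r r_l) T Cs)"
      using represents_nonempty[OF NM(2)] f by (cases "T = 0") (auto simp: committees_def)
    then have "Q r1 h1 (Suc t1)" using 3 by (intro Q) (auto simp: T_def W_def)
    then show ?case using 3 by simp
  qed
qed

definition decide :: ram where
  "decide = IFNZ r_m
     (prepare ;; WHILENZ r_stages stage ;; SUB r_a r_top r_cur ;; ADD r_a r_a r_first ;;
      IFNZ r_a (SETC 0 1) (SETC 0 0))
     (IFNZ r_stages (SETC 0 0) (SETC 0 1))"

definition decider :: ram where
  "decider = SETC r_one 1 ;; SETC r_two 2 ;;
     SETC r_ptr 0 ;; LOAD r_n r_ptr ;; SETC r_ptr 1 ;; LOAD r_m r_ptr ;;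
     SETC r_ptr 2 ;; LOAD r_stages r_ptr ;; SETC r_ptr 3 ;; LOAD r_k r_ptr ;;
     SETC r_ptr 4 ;; LOAD r_l r_ptr ;; SETC r_ptr 5 ;; LOAD r_x r_ptr ;; SETC r_ptr 6 ;; decide"

lemma wp_decider:
  assumes "\<And>r t. r r_one = 1 \<Longrightarrow> r r_two = 2 \<Longrightarrow> r r_zero = 0 \<Longrightarrow> r r_n = h 0 \<Longrightarrow>
    r r_m = h 1 \<Longrightarrow> r r_stages = h 2 \<Longrightarrow> r r_k = h 3 \<Longrightarrow> r r_l = h 4 \<Longrightarrow> r r_x = h 5 \<Longrightarrow>
    r r_ptr = 6 \<Longrightarrow> t \<le> 15 \<Longrightarrow> wp decide Q r h t"
  shows "wp decider Q (\<lambda>_. 0) h 0"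
  unfolding decider_def wp_SEQ wp_SETC wp_LOAD wp_ADD
  by (rule assms) simp_all

lemma wp_decide:
  assumes regs: "r r_one = 1" "r r_two = 2" "r r_zero = 0" "r r_ptr = 6" "r r_n = n" "r r_m = m"
      "r r_stages = T" "r r_k = k" "r r_l = l" "r r_x = x"
    and m: "0 < m"
    and votes: "\<And>a. a < 6 + T * n \<Longrightarrow> 6 \<le> a \<Longrightarrow> h a \<le> m"
    and g: "g = (\<lambda>t j. card {i. i < n \<and> h (6 + t * n + i) = j})"
    and r0: "r0 r_n = n" "r0 r_m = m" "r0 r_L = 2 * l"
    and Q: "\<And>r' h' t'. r' 0 = (if \<exists>Cs. committees g m k x l T Cs then 1 else 0) \<Longrightarrow>
      t' \<le> t + 3 * T + T * (stage_time r0 (Suc (2 * l) * m ^ (2 * l)) + 1) + 17 \<Longrightarrow> Q r' h' t'"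
  shows "wp decide Q r h t"
proof -
  have "wp prepare (wp (WHILENZ r_stages stage ;; SUB r_a r_top r_cur ;; ADD r_a r_a r_first ;;
      IFNZ r_a (SETC 0 1) (SETC 0 0)) Q) r h (Suc t)"
  proof (rule wp_prepare, goal_cases)
    case (3 r1 t1)
    have r1: "\<forall>i<r_L. r1 i = r i" using 3(1) .
    have st: "stage_time r1 N = stage_time r0 N" for N
      by (rule stage_time_cong) (use r1 3(3) regs r0 in auto)
    show ?case
      unfolding wp_SEQ
    proof (rule wp_stages[where g = g], goal_cases)
      case 1
      then show ?case using 3 regs m by (simp add: layout_def)
    next
      case (7 r2 h2 t2)
      have "t2 \<le> t + 3 * T + T * (stage_time r0 (Suc (2 * l) * m ^ (2 * l)) + 1) + 13"
        using 7(2) 3(3,11) r1 regs st by simp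
      then show ?case using 7(1) 3(3) r1 regs
        by (auto intro!: Q)
    qed (use 3 r1 regs votes g in auto)
  qed (use regs in auto)
  then show ?thesis using regs m by (simp add: decide_def)
qed

lemma stage_time_le:
  assumes r: "r r_n = n" "r r_m = m" "r r_L = 2 * l" and m: "0 < m"
    and W: "W = Suc (2 * l) * m ^ (2 * l)"
  shows "stage_time r W \<le> 156 * (W * (W * m * max 1 n))"
proof -
  define E where "E = W * m * max 1 n"
  define p where "p = m ^ (2 * l)"
  have p: "1 \<le> p" using m by (simp add: p_def)
  have Wp: "W = Suc (2 * l) * p" by (simp add: W p_def)
  have W1: "Suc (2 * l) \<le> W" using mult_le_mono2[OF p, of "Suc (2 * l)"] unfolding Wp by simp
  then have "1 \<le> W" by simp
  have mn: "1 \<le> m * max 1 n" "m \<le> m * max 1 n" "m * n \<le> m * max 1 n" "n \<le> m * max 1 n"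
    using m by (simp_all add: mult_le_mono)
      (metis le_trans max.cobounded2 mult_le_mono1 mult_1 Suc_leI One_nat_def)
  have E_ge: "a * b \<le> E" if "a \<le> W" "b \<le> m * max 1 n" for a b
    using mult_le_mono[OF that] by (simp add: E_def mult.assoc)
  have E: "m \<le> E" "n \<le> E" "m * n \<le> E" "2 * l \<le> E" "W \<le> E" "W * m \<le> E" "1 \<le> E"
    using E_ge[of 1 m] E_ge[of 1 n] E_ge[of 1 "m * n"] E_ge[of "2 * l" 1] E_ge[of W 1]
      E_ge[of W m] E_ge[of 1 1] mn \<open>1 \<le> W\<close> W1 by simp_all
  have "try_time r W = 16 * m + 11 * (2 * l) + 15 * (m * n) + 6 * n + 10 * (W * m) + 11 * W + 30"
    using r by (simp add: try_time_def algebra_simps)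
  also have "\<dots> \<le> 99 * E" using E by linarith
  finally have "try_time r W + 10 * (2 * l) + 6 \<le> 115 * E" using E by linarith
  then have "words_time r W \<le> p * (115 * E) + 4 * (2 * l) + 6"
    using r by (simp add: words_time_def p_def)
  then have "words_time r W + 3 \<le> p * (115 * E) + 13 * E" using E by linarith
  also have "\<dots> \<le> p * (115 * E) + p * (13 * E)" using p by simp
  also have "\<dots> = p * (128 * E)" by (simp add: algebra_simps)
  finally have "Suc (2 * l) * (words_time r W + 3) \<le> Suc (2 * l) * (p * (128 * E))"
    by (rule mult_le_mono2)
  also have "\<dots> = 128 * (W * E)" by (simp add: Wp algebra_simps)
  finally have "Suc (2 * l) * (words_time r W + 3) \<le> 128 * (W * E)" .
  moreover have "4 * m + 8 * n + 16 \<le> 28 * E" using E by linarith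
  moreover have "28 * E \<le> 28 * (W * E)" using \<open>1 \<le> W\<close> by simp
  ultimately have "stage_time r W \<le> 156 * (W * E)"
    unfolding stage_time_def r by linarith
  then show ?thesis by (simp add: E_def)
qed

lemma total_time_le:
  assumes r: "r r_n = n" "r r_m = m" "r r_L = 2 * l" and m: "0 < m"
  shows "3 * T + T * (stage_time r (Suc (2 * l) * m ^ (2 * l)) + 1) + 32 \<le>
    1728 * (max 1 T * max 1 l ^ 4 * max 1 m ^ (4 * l + 1) * max 1 n)"
proof -
  define W where "W = Suc (2 * l) * m ^ (2 * l)"
  define U where "U = W * (W * m * max 1 n)"
  define l' where "l' = max 1 l"
  have "1 \<le> W" using m by (simp add: W_def Suc_le_eq del: mult_Suc)
  then have U: "1 \<le> U" using m by (simp add: U_def)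
  have TU: "1 \<le> max 1 T * U" "T \<le> max 1 T * U" "T * U \<le> max 1 T * U"
    using U mult_le_mono[of 1 "max 1 T" 1 U] mult_le_mono[of T "max 1 T" 1 U] by simp_all
  have "T * (stage_time r W + 1) \<le> T * (157 * U)"
    using stage_time_le[OF r m W_def] U unfolding U_def[symmetric] by (intro mult_le_mono2) linarith
  also have "T * (157 * U) = 157 * (T * U)" by simp
  finally have "T * (stage_time r W + 1) \<le> 157 * (max 1 T * U)" using TU(3) by linarith
  then have total: "3 * T + T * (stage_time r W + 1) + 32 \<le> 192 * (max 1 T * U)"
    using TU(1,2) by linarith
  have "Suc (2 * l) \<le> 3 * l'" by (simp add: l'_def)
  then have "Suc (2 * l) * Suc (2 * l) \<le> (3 * l') * (3 * l')" by (rule mult_le_mono) fact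
  also have "\<dots> = 9 * l' ^ 2" by (simp add: power2_eq_square)
  also have "\<dots> \<le> 9 * l' ^ 4" by (simp add: l'_def power_increasing)
  finally have l4: "Suc (2 * l) * Suc (2 * l) \<le> 9 * l' ^ 4" .
  have "U = Suc (2 * l) * Suc (2 * l) * (m ^ (2 * l) * m ^ (2 * l) * m * max 1 n)"
    by (simp add: U_def W_def algebra_simps)
  also have "m ^ (2 * l) * m ^ (2 * l) * m = m ^ (4 * l + 1)"
    by (simp flip: power_add)
  also have "Suc (2 * l) * Suc (2 * l) * (m ^ (4 * l + 1) * max 1 n) \<le>
      9 * l' ^ 4 * (m ^ (4 * l + 1) * max 1 n)"
    using l4 by (rule mult_le_mono1)
  finally have "192 * (max 1 T * U) \<le> 192 * (max 1 T * (9 * l' ^ 4 * (m ^ (4 * l + 1) * max 1 n)))"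
    by (intro mult_le_mono2)
  also have "\<dots> = 1728 * (max 1 T * l' ^ 4 * m ^ (4 * l + 1) * max 1 n)"
    by simp
  also have "m ^ (4 * l + 1) = max 1 m ^ (4 * l + 1)" using m by (simp add: max_def)
  finally show ?thesis using total unfolding W_def l'_def by linarith
qed

section \<open>Encoded instances\<close>

lemma length_takeWhile_nth:
  assumes "distinct xs" "i < length xs"
  shows "length (takeWhile (\<lambda>y. y \<noteq> xs ! i) xs) = i"
proof -
  have "takeWhile (\<lambda>y. y \<noteq> xs ! i) xs = take i xs"
    by (rule takeWhile_eq_take_P_nth) (use assms in \<open>auto simp: nth_eq_iff_index_eq\<close>)
  then show ?thesis using assms by simp
qed

lemma encode_vote_eq_iff:
  assumes "distinct cs" "v \<in> insert None (Some ` set cs)" "j \<in> {1..length cs}"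
  shows "encode_vote cs v = j \<longleftrightarrow> v = Some (cs ! (j - 1))"
proof (cases v)
  case None
  then show ?thesis using assms by auto
next
  case (Some c)
  then obtain i where "i < length cs" "c = cs ! i" using assms by (auto simp: in_set_conv_nth)
  then show ?thesis using Some assms
    by (auto simp: length_takeWhile_nth nth_eq_iff_index_eq)
qed

lemma encode_vote_le:
  assumes "v \<in> insert None (Some ` set cs)"
  shows "encode_vote cs v \<le> length cs"
proof (cases v)
  case (Some c)
  then have "c \<in> set cs" using assms by auto
  then have "length (takeWhile (\<lambda>d. d \<noteq> c) cs) < length cs"
    by (induction cs) auto
  then show ?thesis using Some by simp
qed simp

lemma score_image:
  assumes "distinct as" "set as = A" "distinct cs" "G \<subseteq> {1..length cs}"
    and u: "u ` A \<subseteq> insert None (Some ` set cs)"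
  shows "score A u ((\<lambda>j. cs ! (j - 1)) ` G) =
    (\<Sum>j\<in>G. card {i. i < length as \<and> encode_vote cs (u (as ! i)) = j})"
proof -
  let ?I = "{i. i < length as \<and> encode_vote cs (u (as ! i)) \<in> G}"
  have uin: "u (as ! i) \<in> insert None (Some ` set cs)" if "i < length as" for i
    using u that assms(2) by (metis image_subset_iff nth_mem)
  have iff: "u (as ! i) \<in> Some ` (\<lambda>j. cs ! (j - 1)) ` G \<longleftrightarrow> encode_vote cs (u (as ! i)) \<in> G"
    if "i < length as" for i
  proof -
    have "u (as ! i) \<in> Some ` (\<lambda>j. cs ! (j - 1)) ` G \<longleftrightarrow> (\<exists>j\<in>G. u (as ! i) = Some (cs ! (j - 1)))"
      by auto
    also have "\<dots> \<longleftrightarrow> (\<exists>j\<in>G. encode_vote cs (u (as ! i)) = j)"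
      using encode_vote_eq_iff[OF assms(3) uin[OF that]] assms(4) by blast
    finally show ?thesis by simp
  qed
  have "{a \<in> A. u a \<in> Some ` (\<lambda>j. cs ! (j - 1)) ` G} =
      (\<lambda>i. as ! i) ` {i. i < length as \<and> u (as ! i) \<in> Some ` (\<lambda>j. cs ! (j - 1)) ` G}"
    unfolding assms(2)[symmetric] set_conv_nth by blast
  also have "{i. i < length as \<and> u (as ! i) \<in> Some ` (\<lambda>j. cs ! (j - 1)) ` G} = ?I"
    using iff by blast
  finally have "{a \<in> A. u a \<in> Some ` (\<lambda>j. cs ! (j - 1)) ` G} = (\<lambda>i. as ! i) ` ?I" .
  moreover have "inj_on (\<lambda>i. as ! i) ?I"
    using assms(1) by (auto simp: inj_on_def nth_eq_iff_index_eq)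
  ultimately have "score A u ((\<lambda>j. cs ! (j - 1)) ` G) = card ?I"
    by (simp add: score_def card_image)
  also have "?I = (\<Union>j\<in>G. {i. i < length as \<and> encode_vote cs (u (as ! i)) = j})" by auto
  also have "card \<dots> = (\<Sum>j\<in>G. card {i. i < length as \<and> encode_vote cs (u (as ! i)) = j})"
    by (rule card_UN_disjoint) (use assms(4) finite_subset in auto)
  finally show ?thesis .
qed

lemma rmpv_yes_iff_committees:
  fixes I :: "('a, 'c) rmpv"
  assumes I: "rmpv_instance I" and as: "distinct as" "set as = agents I"
    and cs: "distinct cs" "set cs = candidates I"
    and g: "\<And>t j. t < length (profiles I) \<Longrightarrow>
      g t j = card {i. i < length as \<and> encode_vote cs ((profiles I ! t) (as ! i)) = j}"
  shows "rmpv_yes I \<longleftrightarrow> (\<exists>Gs. committees g (length cs) (committee_size I) (min_score I)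
    (min_change I) (length (profiles I)) Gs)"
proof -
  let ?f = "\<lambda>j. cs ! (j - 1)" and ?m = "length cs" and ?T = "length (profiles I)"
  have inj: "inj_on ?f {1..?m}"
    using cs(1) by (auto simp: inj_on_def nth_eq_iff_index_eq)
  have img: "?f ` {1..?m} = set cs"
  proof
    show "set cs \<subseteq> ?f ` {1..?m}"
    proof
      fix c assume "c \<in> set cs"
      then obtain i where "i < ?m" "c = cs ! i" by (auto simp: in_set_conv_nth)
      then show "c \<in> ?f ` {1..?m}" by (intro image_eqI[of _ _ "Suc i"]) auto
    qed
  qed auto
  have sol: "rmpv_solution I (map ((`) ?f) Gs) \<longleftrightarrow>
      committees g ?m (committee_size I) (min_score I) (min_change I) ?T Gs"
    if Gs: "length Gs = ?T" "\<forall>t<?T. Gs ! t \<subseteq> {1..?m}" for Gs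
  proof -
    have 1: "card (?f ` G) = card G" if "G \<subseteq> {1..?m}" for G
      using inj that by (meson card_image inj_on_subset)
    have 2: "card (sym_diff (?f ` G) (?f ` G')) = card (sym_diff G G')"
      if "G \<subseteq> {1..?m}" "G' \<subseteq> {1..?m}" for G G'
    proof -
      have "sym_diff (?f ` G) (?f ` G') = ?f ` sym_diff G G'"
        using inj_on_image_set_diff[OF inj, of G G'] inj_on_image_set_diff[OF inj, of G' G] that
        by (auto simp: image_Un)
      then show ?thesis using 1[of "sym_diff G G'"] that by auto
    qed
    have 3: "score (agents I) (profiles I ! t) (?f ` (Gs ! t)) = sum (g t) (Gs ! t)" if "t < ?T" for t
      using score_image[OF as cs(1), of "Gs ! t" "profiles I ! t"] Gs that I cs(2) g
      by (auto simp: rmpv_instance_def)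
    have 4: "?f ` (Gs ! t) \<subseteq> candidates I" if "t < ?T" for t
      using Gs that img cs(2) by (metis image_mono)
    show ?thesis
      unfolding rmpv_solution_def committees_def
      using Gs 1 2 3 4 by auto
  qed
  show ?thesis
  proof
    assume "rmpv_yes I"
    then obtain Cs where Cs: "rmpv_solution I Cs" by (auto simp: rmpv_yes_def)
    define Gs where "Gs = map (\<lambda>C. {j \<in> {1..?m}. ?f j \<in> C}) Cs"
    have len: "length Cs = ?T" using Cs by (simp add: rmpv_solution_def)
    have "?f ` {j \<in> {1..?m}. ?f j \<in> C} = C" if "C \<subseteq> set cs" for C
      using that unfolding img[symmetric] by blast
    then have "map ((`) ?f) Gs = Cs"
      using Cs cs(2) by (intro nth_equalityI) (auto simp: Gs_def rmpv_solution_def)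
    moreover have "length Gs = ?T" "\<forall>t<?T. Gs ! t \<subseteq> {1..?m}" using len by (auto simp: Gs_def)
    ultimately show "\<exists>Gs. committees g ?m (committee_size I) (min_score I) (min_change I) ?T Gs"
      using sol[of Gs] Cs by (intro exI[of _ Gs]) simp
  next
    assume "\<exists>Gs. committees g ?m (committee_size I) (min_score I) (min_change I) ?T Gs"
    then obtain Gs where Gs: "committees g ?m (committee_size I) (min_score I) (min_change I) ?T Gs" ..
    then have "length Gs = ?T" "\<forall>t<?T. Gs ! t \<subseteq> {1..?m}" by (auto simp: committees_def)
    with sol Gs show "rmpv_yes I" unfolding rmpv_yes_def by blast
  qed
qed

lemma nth_concat_uniform:
  assumes "\<forall>xs\<in>set xss. length xs = n" "t < length xss" "i < n"
  shows "concat xss ! (t * n + i) = xss ! t ! i"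
  using assms
proof (induction xss arbitrary: t)
  case (Cons xs xss)
  then show ?case by (cases t) (auto simp: nth_append)
qed simp

lemma length_concat_uniform:
  assumes "\<forall>xs\<in>set xss. length xs = n"
  shows "length (concat xss) = length xss * n"
  using assms by (induction xss) auto

lemma encode_rmpv_header:
  fixes I :: "('a, 'c) rmpv" and as :: "'a list" and cs :: "'c list"
  defines "h \<equiv> snd (initial_store (encode_rmpv I as cs))"
  shows "h 0 = length as" "h 1 = length cs" "h 2 = length (profiles I)"
    "h 3 = committee_size I" "h 4 = min_change I" "h 5 = min_score I"
  by (simp_all add: h_def initial_store_def encode_rmpv_def)

lemma encode_rmpv_vote:
  fixes I :: "('a, 'c) rmpv"
  assumes "t < length (profiles I)" "i < length as"
  shows "snd (initial_store (encode_rmpv I as cs)) (6 + t * length as + i) =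
    encode_vote cs ((profiles I ! t) (as ! i))"
proof -
  define xss where "xss = map (\<lambda>u. map (\<lambda>a. encode_vote cs (u a)) as) (profiles I)"
  have u: "\<forall>xs\<in>set xss. length xs = length as" by (auto simp: xss_def)
  have t: "t < length xss" using assms by (simp add: xss_def)
  have "t * length as + i < length xss * length as"
    using record_bound[OF t, of "Suc i" "length as"] assms(2) by simp
  then have "snd (initial_store (encode_rmpv I as cs)) (6 + t * length as + i) =
      concat xss ! (t * length as + i)"
    by (simp add: initial_store_def encode_rmpv_def length_concat_uniform[OF u] nth_append
        flip: xss_def)
  also have "\<dots> = xss ! t ! i" by (rule nth_concat_uniform[OF u t assms(2)])
  finally show ?thesis using assms by (simp add: xss_def)
qed

lemma decider_decides:
  fixes I :: "('a, 'c) rmpv"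
  assumes I: "rmpv_instance I" and as: "distinct as" "set as = agents I"
    and cs: "distinct cs" "set cs = candidates I"
  shows "decides_within decider (encode_rmpv I as cs) (rmpv_yes I)
    (1728 * (max 1 (length (profiles I)) * max 1 (min_change I) ^ 4 *
       max 1 (length cs) ^ (4 * min_change I + 1) * max 1 (length as)))" (is "decides_within _ _ _ ?B")
proof -
  define B where "B = ?B"
  define h where "h = snd (initial_store (encode_rmpv I as cs))"
  note head = encode_rmpv_header[of I as cs, folded h_def]
  note vote = encode_rmpv_vote[of _ I _ as cs, folded h_def]
  let ?n = "length as" and ?m = "length cs" and ?T = "length (profiles I)"
  have "wp decider (\<lambda>r' h' t'. r' 0 = (if rmpv_yes I then 1 else 0) \<and> t' \<le> B) (\<lambda>_. 0) h 0"
  proof (rule wp_decider)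
    fix r :: "nat \<Rightarrow> nat" and t :: nat
    assume r: "r r_one = 1" "r r_two = 2" "r r_zero = 0" "r r_n = h 0" "r r_m = h 1"
      "r r_stages = h 2" "r r_k = h 3" "r r_l = h 4" "r r_x = h 5" "r r_ptr = 6" and t: "t \<le> 15"
    show "wp decide (\<lambda>r' h' t'. r' 0 = (if rmpv_yes I then 1 else 0) \<and> t' \<le> B) r h t"
    proof (cases "?m = 0")
      case True
      then have no: "candidates I = {}" using cs by simp
      have yes: "rmpv_yes I \<longleftrightarrow> ?T = 0"
      proof
        assume "rmpv_yes I"
        then obtain Cs where Cs: "rmpv_solution I Cs" by (auto simp: rmpv_yes_def)
        show "?T = 0"
        proof (rule ccontr)
          assume "?T \<noteq> 0"
          then have "Cs ! 0 = {}" "min_score I \<le> score (agents I) (profiles I ! 0) (Cs ! 0)"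
            using Cs no by (auto simp: rmpv_solution_def)
          then show False using I by (simp add: score_def rmpv_instance_def)
        qed
      next
        assume "?T = 0"
        then have "rmpv_solution I []" by (simp add: rmpv_solution_def)
        then show "rmpv_yes I" by (auto simp: rmpv_yes_def)
      qed
      have "1 \<le> max 1 ?T * max 1 (min_change I) ^ 4 *
          max 1 ?m ^ (4 * min_change I + 1) * max 1 ?n"
        by (simp add: Suc_le_eq less_max_iff_disj)
      then have "18 \<le> B" unfolding B_def by linarith
      then show ?thesis using r t True head yes by (simp add: decide_def)
    next
      case False
      define g where "g = (\<lambda>t j. card {i. i < ?n \<and> h (6 + t * ?n + i) = j})"
      define r0 where "r0 = (\<lambda>i. if i = r_n then ?n else if i = r_m then ?m else 2 * min_change I)"
      have r0: "r0 r_n = ?n" "r0 r_m = ?m" "r0 r_L = 2 * min_change I" by (simp_all add: r0_def)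
      have gt: "g t j = card {i. i < ?n \<and> encode_vote cs ((profiles I ! t) (as ! i)) = j}"
        if "t < ?T" for t j
      proof -
        have "{i. i < ?n \<and> h (6 + t * ?n + i) = j} =
            {i. i < ?n \<and> encode_vote cs ((profiles I ! t) (as ! i)) = j}"
          using vote[OF that] by auto
        then show ?thesis by (simp add: g_def)
      qed
      have vle: "h a \<le> ?m" if "a < 6 + ?T * ?n" "6 \<le> a" for a
      proof -
        have "a - 6 < ?T * ?n" using that by linarith
        then have n: "0 < ?n" and "(a - 6) div ?n < ?T"
          by (auto simp: less_mult_imp_div_less intro: Nat.gr0I)
        moreover have "(a - 6) mod ?n < ?n" using n by simp
        moreover have "a = 6 + (a - 6) div ?n * ?n + (a - 6) mod ?n"
          using that(2) by (simp add: add.assoc)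
        ultimately have "h a = encode_vote cs ((profiles I ! ((a - 6) div ?n)) (as ! ((a - 6) mod ?n)))"
          using vote by metis
        moreover have "(profiles I ! ((a - 6) div ?n)) (as ! ((a - 6) mod ?n)) \<in> insert None (Some ` set cs)"
          using I as cs \<open>(a - 6) div ?n < ?T\<close> \<open>(a - 6) mod ?n < ?n\<close>
          unfolding rmpv_instance_def by (metis image_subset_iff nth_mem)
        ultimately show ?thesis using encode_vote_le by metis
      qed
      have "rmpv_yes I \<longleftrightarrow> (\<exists>Cs. committees g ?m (committee_size I) (min_score I) (min_change I) ?T Cs)"
        by (rule rmpv_yes_iff_committees[OF I as cs gt])
      moreover have "3 * ?T + ?T * (stage_time r0 (Suc (2 * min_change I) * ?m ^ (2 * min_change I)) + 1)
          + 32 \<le> B"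
        unfolding B_def by (rule total_time_le[OF r0]) (use False in simp)
      ultimately show ?thesis
        using r head t False
        by (intro wp_decide[OF r(1-3) _ _ _ _ _ _ _ _ _ g_def r0]) (auto intro: vle)
    qed
  qed
  then obtain u r' h' where "exec decider (\<lambda>_. 0, h) u (r', h')"
    "r' 0 = (if rmpv_yes I then 1 else 0)" "u \<le> B"
    unfolding wp_def by auto
  moreover have "initial_store (encode_rmpv I as cs) = (\<lambda>_. 0, h)"
    by (simp add: h_def initial_store_def)
  ultimately show ?thesis unfolding decides_within_def B_def by (metis fst_conv)
qed

theorem theorem9:
  "\<exists>(p :: ram) (K :: nat). \<forall>(I :: ('a, 'c) rmpv) as cs n m \<tau> l.
     rmpv_instance I \<longrightarrow>
     distinct as \<longrightarrow> set as = agents I \<longrightarrow> distinct cs \<longrightarrow> set cs = candidates I \<longrightarrow>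
     n = card (agents I) \<longrightarrow> m = card (candidates I) \<longrightarrow>
     \<tau> = length (profiles I) \<longrightarrow> l = min_change I \<longrightarrow>
     decides_within p (encode_rmpv I as cs) (rmpv_yes I)
       (K * (max 1 \<tau> * max 1 l ^ 4 * max 1 m ^ (4 * l + 1) * max 1 n))"
proof (intro exI allI impI)
  fix I :: "('a, 'c) rmpv" and as cs n m \<tau> l
  assume "rmpv_instance I" and as: "distinct as" "set as = agents I"
    and cs: "distinct cs" "set cs = candidates I"
    and "n = card (agents I)" "m = card (candidates I)" "\<tau> = length (profiles I)" "l = min_change I"
  moreover have "card (agents I) = length as" "card (candidates I) = length cs"
    using distinct_card as cs by metis+
  ultimately show "decides_within decider (encode_rmpv I as cs) (rmpv_yes I)
      (1728 * (max 1 \<tau> * max 1 l ^ 4 * max 1 m ^ (4 * l + 1) * max 1 n))"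
    using decider_decides by metis
qed

end
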